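(* For every $\varepsilon>0$ there exist a weighted graph $G=(V,E,w)$ with no self-loops and an optimal solution $f_{\mathrm{SDP}}:V\to S^{N-1}$ ($N=|V|$) of $\mathrm{SDP}_{\mathrm{Prod}}(G)$ such that, if $\mathbf{Z}$ is a $3\times N$ matrix of i.i.d. standard Gaussians, \[\mathbb{E}_{\mathbf{Z}}\,\mathbb{E}_{(\mathbf{u},\mathbf{v})\sim E}\Big[\tfrac14-\tfrac14\Big\langle\tfrac{\mathbf{Z}f_{\mathrm{SDP}}(\mathbf{u})}{\|\mathbf{Z}f_{\mathrm{SDP}}(\mathbf{u})\|},\tfrac{\mathbf{Z}f_{\mathrm{SDP}}(\mathbf{v})}{\|\mathbf{Z}f_{\mathrm{SDP}}(\mathbf{v})\|}\Big\rangle\Big]\le(\alpha_{\mathrm{BOV}}+\varepsilon)\,\mathrm{Prod}(G).\]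
   Context: A weighted graph $G=(V,E,w)$ is a finite undirected graph with nonnegative edge weights summing to $1$; $(\mathbf{u},\mathbf{v})\sim E$ is a random edge. $\mathrm{Prod}(G)=\max_{f:V\to S^2}\mathbb{E}_{(\mathbf{u},\mathbf{v})\sim E}[\tfrac14-\tfrac14\langle f(\mathbf{u}),f(\mathbf{v})\rangle]$ (the product state value of the Quantum Max-Cut instance on $G$), and $\mathrm{SDP}_{\mathrm{Prod}}(G)=\max_{f:V\to S^{N-1}}\mathbb{E}_{(\mathbf{u},\mathbf{v})\sim E}[\tfrac14-\tfrac14\langle f(\mathbf{u}),f(\mathbf{v})\rangle]$. For $k\ge1$ and $\rho\in[-1,1]$, $F^*(k,\rho)=\mathbb{E}\big\langle \mathbf{Z}u/\|\mathbf{Z}u\|,\mathbf{Z}v/\|\mathbf{Z}v\|\big\rangle$ where $u,v\in\mathbb{R}^m$ ($m\ge2$) are unit vectors with $\langle u,v\rangle=\rho$ and $\mathbf{Z}$ is a $k\times m$ matrix of i.i.d. standard Gaussians (this depends only on $k,\rho$; explicitly $F^*(k,\rho)=\frac2k\big(\frac{\Gamma((k+1)/2)}{\Gamma(k/2)}\big)^2\rho\,{}_2F_1(\tfrac12,\tfrac12;\tfrac k2+1;\rho^2)$). $\alpha_{\mathrm{BOV}}=\min_{-1\le\rho<1}\frac{\frac14-\frac14F^*(3,\rho)}{\frac14-\frac14\rho}$ ($\approx0.956$). *)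

theory Defs
  imports "HOL-Probability.Probability"
begin

(* Vectors in R^d are functions nat => real; only components i < d matter. *)
definition ip :: "nat \<Rightarrow> (nat \<Rightarrow> real) \<Rightarrow> (nat \<Rightarrow> real) \<Rightarrow> real" where
  "ip d x y = (\<Sum>i<d. x i * y i)"

definition unitv :: "nat \<Rightarrow> (nat \<Rightarrow> real) \<Rightarrow> bool" where
  "unitv d x \<longleftrightarrow> ip d x x = 1"

definition vnormalize :: "nat \<Rightarrow> (nat \<Rightarrow> real) \<Rightarrow> (nat \<Rightarrow> real)" where
  "vnormalize d x = (\<lambda>i. x i / sqrt (ip d x x))"

definition matvec :: "nat \<Rightarrow> (nat \<times> nat \<Rightarrow> real) \<Rightarrow> (nat \<Rightarrow> real) \<Rightarrow> (nat \<Rightarrow> real)" where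
  "matvec m Z x = (\<lambda>i. \<Sum>j<m. Z (i, j) * x j)"

definition gauss_mat :: "nat \<Rightarrow> nat \<Rightarrow> (nat \<times> nat \<Rightarrow> real) measure" where
  "gauss_mat k m = PiM ({..<k} \<times> {..<m}) (\<lambda>_. density lborel std_normal_density)"

(* Weighted graph on vertex set V = {0..<N}: w u v is the probability of the
   ordered pair (u,v) as the random edge; nonnegative, summing to 1, no self-loops. *)
definition wgraph :: "nat \<Rightarrow> (nat \<Rightarrow> nat \<Rightarrow> real) \<Rightarrow> bool" where
  "wgraph N w \<longleftrightarrow> (\<forall>u v. 0 \<le> w u v) \<and> (\<Sum>u<N. \<Sum>v<N. w u v) = 1"

definition no_self_loops :: "nat \<Rightarrow> (nat \<Rightarrow> nat \<Rightarrow> real) \<Rightarrow> bool" where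
  "no_self_loops N w \<longleftrightarrow> (\<forall>u<N. w u u = 0)"

definition edge_exp :: "nat \<Rightarrow> (nat \<Rightarrow> nat \<Rightarrow> real) \<Rightarrow> (nat \<Rightarrow> nat \<Rightarrow> real) \<Rightarrow> real" where
  "edge_exp N w g = (\<Sum>u<N. \<Sum>v<N. w u v * g u v)"

definition qmc_obj :: "nat \<Rightarrow> nat \<Rightarrow> (nat \<Rightarrow> nat \<Rightarrow> real) \<Rightarrow> (nat \<Rightarrow> nat \<Rightarrow> real) \<Rightarrow> real" where
  "qmc_obj d N w f = edge_exp N w (\<lambda>u v. 1/4 - 1/4 * ip d (f u) (f v))"

definition Prod :: "nat \<Rightarrow> (nat \<Rightarrow> nat \<Rightarrow> real) \<Rightarrow> real" where
  "Prod N w = Sup {qmc_obj 3 N w f | f. \<forall>u<N. unitv 3 (f u)}"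

definition sdp_optimal :: "nat \<Rightarrow> (nat \<Rightarrow> nat \<Rightarrow> real) \<Rightarrow> (nat \<Rightarrow> nat \<Rightarrow> real) \<Rightarrow> bool" where
  "sdp_optimal N w f \<longleftrightarrow> (\<forall>u<N. unitv N (f u)) \<and>
     (\<forall>g. (\<forall>u<N. unitv N (g u)) \<longrightarrow> qmc_obj N N w g \<le> qmc_obj N N w f)"

(* F*(k,rho), realised with m = 2, u = (1,0), v = (rho, sqrt(1-rho^2)) *)
definition Fstar :: "nat \<Rightarrow> real \<Rightarrow> real" where
  "Fstar k \<rho> = (let u = (\<lambda>i. if i = 0 then 1 else 0 :: real);
                      v = (\<lambda>i. if i = 0 then \<rho> else if i = 1 then sqrt (1 - \<rho>\<^sup>2) else 0) in
     LINT Z | gauss_mat k 2. ip k (vnormalize k (matvec 2 Z u)) (vnormalize k (matvec 2 Z v)))"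

definition alpha_BOV :: real where
  "alpha_BOV = Inf {(1/4 - 1/4 * Fstar 3 \<rho>) / (1/4 - 1/4 * \<rho>) | \<rho>. -1 \<le> \<rho> \<and> \<rho> < 1}"

end

theory Submission
  imports Defs
begin

text \<open>
  For \<open>\<rho> \<in> [-1, 0]\<close> take the noisy hypercube on \<open>{-1, 1}\<^sup>n\<close>: the random edge is a pair of
  \<open>\<rho>\<close>-correlated uniform points. Its eigenvalues are the powers of \<open>\<rho>\<close>, the least of which is
  \<open>\<rho>\<close> itself, attained at the coordinate functions. Hence both the single coordinate cut, which
  is a product state, and the embedding \<open>x \<mapsto> x / sqrt n\<close> attain the SDP value \<open>(1 - \<rho>) / 4\<close>.
  Rounding the embedding gives the expectation of \<open>(1 - F*(3, X)) / 4\<close> for the inner product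
  \<open>X\<close> of a random edge, and \<open>X\<close> concentrates at \<open>\<rho>\<close>, so the ratio tends to the one defining
  \<open>\<alpha>\<close> at \<open>\<rho>\<close>. Positive \<open>\<rho>\<close> may be ignored in the infimum: rounding is feasible on the
  hypercube, so \<open>F*(3, \<rho>) \<ge> \<rho>\<close> for \<open>\<rho> \<le> 0\<close>, and as \<open>F*\<close> is odd the ratio is at least \<open>1\<close>
  for \<open>\<rho> \<ge> 0\<close>, with equality at \<open>0\<close>.
\<close>

section \<open>Gaussian rounding\<close>

lemma nn_integral_lborel_reflection:
  fixes h :: "real \<times> real \<Rightarrow> ennreal"
  assumes h[measurable]: "h \<in> borel_measurable (borel \<Otimes>\<^sub>M borel)" and cs: "c\<^sup>2 + s\<^sup>2 = 1"
  shows "(\<integral>\<^sup>+y. \<integral>\<^sup>+x. h (c * x + s * y, s * x - c * y) \<partial>lborel \<partial>lborel)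
       = (\<integral>\<^sup>+y. \<integral>\<^sup>+x. h (x, y) \<partial>lborel \<partial>lborel)"
proof (cases "c = 0")
  case True
  then have s: "s \<noteq> 0" "\<bar>s\<bar> = 1" using cs by (auto simp: power2_eq_1_iff)
  have "(\<integral>\<^sup>+y. \<integral>\<^sup>+x. h (c * x + s * y, s * x - c * y) \<partial>lborel \<partial>lborel)
      = (\<integral>\<^sup>+y. (\<integral>\<^sup>+x. h (0 + s * y, 0 + s * x) \<partial>lborel) \<partial>lborel)"
    using True by simp
  also have "\<dots> = (\<integral>\<^sup>+y. (\<integral>\<^sup>+x. h (0 + s * y, x) \<partial>lborel) \<partial>lborel)"
    using nn_integral_real_affine[of "\<lambda>x. h (0 + s * _, x)" s 0] s by simp
  also have "\<dots> = (\<integral>\<^sup>+y. (\<integral>\<^sup>+x. h (y, x) \<partial>lborel) \<partial>lborel)"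
    using nn_integral_real_affine[of "\<lambda>y. (\<integral>\<^sup>+x. h (y, x) \<partial>lborel)" s 0] s by simp
  also have "\<dots> = (\<integral>\<^sup>+y. \<integral>\<^sup>+x. h (x, y) \<partial>lborel \<partial>lborel)"
    by (rule lborel_pair.Fubini') simp
  finally show ?thesis .
next
  case False
  \<comment> \<open>For \<open>c \<noteq> 0\<close> the reflection factors into two one-dimensional
    affine substitutions: the first coordinate replaces \<open>x\<close> at fixed \<open>y\<close>,
    then \<open>eq\<close> makes the second one affine in \<open>y\<close> with slope
    \<open>- 1 / c\<close>. The Jacobians cancel.\<close>
  have eq: "s * x - c * y = s / c * (s * y + c * x) + (- 1 / c) * y" for x y
  proof -
    have "s / c * (s * y + c * x) + (- 1 / c) * y = (s\<^sup>2 - 1) / c * y + s * x"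
      using False by (simp add: field_simps power2_eq_square)
    also have "s\<^sup>2 - 1 = - (c * c)" using cs by (simp add: power2_eq_square)
    finally show ?thesis using False by simp
  qed
  have "ennreal \<bar>c\<bar> * (\<integral>\<^sup>+y. \<integral>\<^sup>+x. h (c * x + s * y, s * x - c * y) \<partial>lborel \<partial>lborel)
      = (\<integral>\<^sup>+y. ennreal \<bar>c\<bar> * (\<integral>\<^sup>+x. h (c * x + s * y, s * x - c * y) \<partial>lborel) \<partial>lborel)"
    by (rule nn_integral_cmult[symmetric]) simp
  also have "\<dots> = (\<integral>\<^sup>+y. ennreal \<bar>c\<bar> * (\<integral>\<^sup>+x. h (s * y + c * x, s / c * (s * y + c * x) + (- 1 / c) * y) \<partial>lborel) \<partial>lborel)"
    by (subst eq) (simp add: add.commute)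
  also have "\<dots> = (\<integral>\<^sup>+y. (\<integral>\<^sup>+x. h (x, s / c * x + (- 1 / c) * y) \<partial>lborel) \<partial>lborel)"
    by (intro nn_integral_cong nn_integral_real_affine[symmetric]) (use False in auto)
  also have "\<dots> = (\<integral>\<^sup>+x. (\<integral>\<^sup>+y. h (x, s / c * x + (- 1 / c) * y) \<partial>lborel) \<partial>lborel)"
    by (rule lborel_pair.Fubini') simp
  also have "\<dots> = (\<integral>\<^sup>+x. ennreal \<bar>c\<bar> * (ennreal \<bar>- 1 / c\<bar> * (\<integral>\<^sup>+y. h (x, s / c * x + (- 1 / c) * y) \<partial>lborel)) \<partial>lborel)"
    using False by (simp add: mult.assoc[symmetric] ennreal_mult[symmetric])
  also have "\<dots> = (\<integral>\<^sup>+x. ennreal \<bar>c\<bar> * (\<integral>\<^sup>+y. h (x, y) \<partial>lborel) \<partial>lborel)"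
    by (intro nn_integral_cong arg_cong[where f="\<lambda>z. ennreal \<bar>c\<bar> * z"] nn_integral_real_affine[symmetric])
      (use False in auto)
  also have "\<dots> = ennreal \<bar>c\<bar> * (\<integral>\<^sup>+x. (\<integral>\<^sup>+y. h (x, y) \<partial>lborel) \<partial>lborel)"
    by (rule nn_integral_cmult) simp
  also have "(\<integral>\<^sup>+x. (\<integral>\<^sup>+y. h (x, y) \<partial>lborel) \<partial>lborel) = (\<integral>\<^sup>+y. \<integral>\<^sup>+x. h (x, y) \<partial>lborel \<partial>lborel)"
    by (rule lborel_pair.Fubini') simp
  finally show ?thesis
    using False by (simp add: ennreal_mult_cancel_left)
qed

abbreviation gauss :: "real measure" where
  "gauss \<equiv> density lborel std_normal_density"

lemma prob_space_gauss: "prob_space gauss"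
  by (rule prob_space_normal_density) simp

text \<open>The joint density depends only on the sum of squares, which the reflection preserves, so
  the Lebesgue case applies to density times \<open>h\<close>.\<close>

lemma nn_integral_gauss_reflection:
  fixes h :: "real \<times> real \<Rightarrow> ennreal"
  assumes h[measurable]: "h \<in> borel_measurable (borel \<Otimes>\<^sub>M borel)" and cs: "c\<^sup>2 + s\<^sup>2 = 1"
  shows "(\<integral>\<^sup>+y. \<integral>\<^sup>+x. h (c * x + s * y, s * x - c * y) \<partial>gauss \<partial>gauss)
       = (\<integral>\<^sup>+y. \<integral>\<^sup>+x. h (x, y) \<partial>gauss \<partial>gauss)"
proof -
  define D where "D p = ennreal (std_normal_density (fst p) * std_normal_density (snd p))" for p
  have [measurable]: "D \<in> borel_measurable (borel \<Otimes>\<^sub>M borel)"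
    unfolding D_def by measurable
  have int: "(\<integral>\<^sup>+y. \<integral>\<^sup>+x. g (x, y) \<partial>gauss \<partial>gauss) = (\<integral>\<^sup>+y. \<integral>\<^sup>+x. D (x, y) * g (x, y) \<partial>lborel \<partial>lborel)"
    if [measurable]: "g \<in> borel_measurable (borel \<Otimes>\<^sub>M borel)" for g :: "real \<times> real \<Rightarrow> ennreal"
  proof -
    have "(\<integral>\<^sup>+y. \<integral>\<^sup>+x. g (x, y) \<partial>gauss \<partial>gauss)
        = (\<integral>\<^sup>+y. ennreal (std_normal_density y) * (\<integral>\<^sup>+x. ennreal (std_normal_density x) * g (x, y) \<partial>lborel) \<partial>lborel)"
      by (simp add: nn_integral_density)
    also have "\<dots> = (\<integral>\<^sup>+y. (\<integral>\<^sup>+x. ennreal (std_normal_density y) * (ennreal (std_normal_density x) * g (x, y)) \<partial>lborel) \<partial>lborel)"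
      by (simp add: nn_integral_cmult)
    finally show ?thesis
      by (simp add: D_def ennreal_mult ac_simps)
  qed
  have D: "D (c * x + s * y, s * x - c * y) = D (x, y)" for x y
  proof -
    have "(c * x + s * y)\<^sup>2 + (s * x - c * y)\<^sup>2 = (c\<^sup>2 + s\<^sup>2) * (x\<^sup>2 + y\<^sup>2)"
      by (simp add: power2_eq_square algebra_simps)
    then have "(c * x + s * y)\<^sup>2 + (s * x - c * y)\<^sup>2 = x\<^sup>2 + y\<^sup>2"
      using cs by simp
    then have "exp (- (c * x + s * y)\<^sup>2 / 2) * exp (- (s * x - c * y)\<^sup>2 / 2) = exp (- x\<^sup>2 / 2) * exp (- y\<^sup>2 / 2)"
      unfolding exp_add[symmetric] by (simp add: field_simps)
    then show ?thesis
      by (simp add: D_def std_normal_density_def)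
  qed
  have "(\<integral>\<^sup>+y. \<integral>\<^sup>+x. h (c * x + s * y, s * x - c * y) \<partial>gauss \<partial>gauss)
      = (\<integral>\<^sup>+y. \<integral>\<^sup>+x. D (x, y) * h (c * x + s * y, s * x - c * y) \<partial>lborel \<partial>lborel)"
    using int[of "\<lambda>(x, y). h (c * x + s * y, s * x - c * y)"] by simp
  also have "\<dots> = (\<integral>\<^sup>+y. \<integral>\<^sup>+x. D (x, y) * h (x, y) \<partial>lborel \<partial>lborel)"
    using nn_integral_lborel_reflection[of "\<lambda>p. D p * h p", OF _ cs] by (simp add: D)
  also have "\<dots> = (\<integral>\<^sup>+y. \<integral>\<^sup>+x. h (x, y) \<partial>gauss \<partial>gauss)"
    by (simp add: int)
  finally show ?thesis .
qed

text \<open>For \<open>a \<noteq> b\<close> and \<open>(c, s)\<close> on the unit circle this is a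
  reflection in the plane of axes \<open>a\<close> and \<open>b\<close>. Unlike a rotation it is its
  own transpose and inverse.\<close>

definition reflect2 :: "'i \<Rightarrow> 'i \<Rightarrow> real \<Rightarrow> real \<Rightarrow> ('i \<Rightarrow> real) \<Rightarrow> 'i \<Rightarrow> real" where
  "reflect2 a b c s x = x(a := c * x a + s * x b, b := s * x a - c * x b)"

lemma reflect2_measurable:
  assumes "a \<in> I" "b \<in> I"
  shows "reflect2 a b c s \<in> PiM I (\<lambda>_. gauss) \<rightarrow>\<^sub>M PiM I (\<lambda>_. gauss)"
proof -
  have [measurable]: "(\<lambda>x. x a) \<in> PiM I (\<lambda>_. gauss) \<rightarrow>\<^sub>M borel" "(\<lambda>x. x b) \<in> PiM I (\<lambda>_. gauss) \<rightarrow>\<^sub>M borel"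
    using measurable_component_singleton[OF assms(1), of "\<lambda>_. gauss"]
      measurable_component_singleton[OF assms(2), of "\<lambda>_. gauss"] by simp_all
  show ?thesis
    unfolding reflect2_def using assms
    by (intro measurable_fun_upd[of I I, OF _ measurable_fun_upd[of I I]]) auto
qed

text \<open>By Tonelli the coordinates outside \<open>{a, b}\<close> are integrated out first. What
  remains is a function \<open>h\<close> on the plane, to which the two-dimensional invariance
  applies.\<close>

lemma distr_reflect2:
  assumes fin: "finite I" and ab: "a \<in> I" "b \<in> I" "a \<noteq> b" and cs: "c\<^sup>2 + s\<^sup>2 = 1"
  shows "distr (PiM I (\<lambda>_. gauss)) (PiM I (\<lambda>_. gauss)) (reflect2 a b c s) = PiM I (\<lambda>_. gauss)"
proof -
  interpret prob_space gauss by (rule prob_space_gauss)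
  interpret P: product_sigma_finite "\<lambda>_. gauss" by unfold_locales
  define J where "J = I - {a, b}"
  have I: "I = insert b (insert a J)" and J: "finite J" "a \<notin> J" "b \<notin> insert a J"
    using fin ab by (auto simp: J_def)
  have key: "(\<integral>\<^sup>+x. f (reflect2 a b c s x) \<partial>PiM I (\<lambda>_. gauss)) = (\<integral>\<^sup>+x. f x \<partial>PiM I (\<lambda>_. gauss))"
    if f[measurable]: "f \<in> borel_measurable (PiM I (\<lambda>_. gauss))" for f :: "_ \<Rightarrow> ennreal"
  proof -
    have [measurable]: "reflect2 a b c s \<in> PiM I (\<lambda>_. gauss) \<rightarrow>\<^sub>M PiM I (\<lambda>_. gauss)"
      using ab by (intro reflect2_measurable)
    have split: "(\<integral>\<^sup>+x. g x \<partial>PiM I (\<lambda>_. gauss)) = (\<integral>\<^sup>+q. \<integral>\<^sup>+p. \<integral>\<^sup>+x. g (x(a := p, b := q)) \<partial>PiM J (\<lambda>_. gauss) \<partial>gauss \<partial>gauss)"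
      if g: "g \<in> borel_measurable (PiM I (\<lambda>_. gauss))" for g :: "_ \<Rightarrow> ennreal"
    proof -
      have g': "g \<in> borel_measurable (PiM (insert b (insert a J)) (\<lambda>_. gauss))"
        using g I by simp
      have "(\<integral>\<^sup>+x. g x \<partial>PiM I (\<lambda>_. gauss)) = (\<integral>\<^sup>+q. \<integral>\<^sup>+x. g (x(b := q)) \<partial>PiM (insert a J) (\<lambda>_. gauss) \<partial>gauss)"
        unfolding I using J g' by (intro P.product_nn_integral_insert_rev) auto
      also have "\<dots> = (\<integral>\<^sup>+q. \<integral>\<^sup>+p. \<integral>\<^sup>+x. g (x(a := p, b := q)) \<partial>PiM J (\<lambda>_. gauss) \<partial>gauss \<partial>gauss)"
      proof (rule nn_integral_cong)
        fix q :: real assume "q \<in> space gauss"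
        then have "(\<lambda>x. x(b := q)) \<in> PiM (insert a J) (\<lambda>_. gauss) \<rightarrow>\<^sub>M PiM (insert b (insert a J)) (\<lambda>_. gauss)"
          by (intro measurable_fun_upd[where J="insert a J"]) auto
        from measurable_compose[OF this g']
        show "(\<integral>\<^sup>+x. g (x(b := q)) \<partial>PiM (insert a J) (\<lambda>_. gauss)) = (\<integral>\<^sup>+p. \<integral>\<^sup>+x. g (x(a := p, b := q)) \<partial>PiM J (\<lambda>_. gauss) \<partial>gauss)"
          using J by (intro P.product_nn_integral_insert_rev) auto
      qed
      finally show ?thesis .
    qed
    interpret PJ: sigma_finite_measure "PiM J (\<lambda>_. gauss)"
      by (intro P.sigma_finite J)
    define h where "h p = (\<integral>\<^sup>+x. f (x(a := fst p, b := snd p)) \<partial>PiM J (\<lambda>_. gauss))" for p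
    have upd: "(\<lambda>z. (snd z)(a := fst (fst z), b := snd (fst z)))
        \<in> (borel \<Otimes>\<^sub>M borel) \<Otimes>\<^sub>M PiM J (\<lambda>_. gauss) \<rightarrow>\<^sub>M PiM I (\<lambda>_. gauss)"
      unfolding I
      by (intro measurable_fun_upd[where J="insert a J"] measurable_fun_upd[where J=J]) auto
    have [measurable]: "h \<in> borel_measurable (borel \<Otimes>\<^sub>M borel)"
      unfolding h_def
      using measurable_compose[OF upd f]
      by (intro PJ.borel_measurable_nn_integral) (simp add: split_beta')
    have "(\<integral>\<^sup>+x. f (reflect2 a b c s x) \<partial>PiM I (\<lambda>_. gauss))
        = (\<integral>\<^sup>+q. \<integral>\<^sup>+p. h (c * p + s * q, s * p - c * q) \<partial>gauss \<partial>gauss)"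
      using ab by (subst split) (simp, simp add: h_def reflect2_def fun_upd_twist)
    also have "\<dots> = (\<integral>\<^sup>+q. \<integral>\<^sup>+p. h (p, q) \<partial>gauss \<partial>gauss)"
      by (rule nn_integral_gauss_reflection[OF _ cs]) simp
    also have "\<dots> = (\<integral>\<^sup>+x. f x \<partial>PiM I (\<lambda>_. gauss))"
      by (subst split) (simp_all add: h_def)
    finally show ?thesis .
  qed
  have R: "reflect2 a b c s \<in> PiM I (\<lambda>_. gauss) \<rightarrow>\<^sub>M PiM I (\<lambda>_. gauss)"
    using ab by (intro reflect2_measurable)
  show ?thesis
  proof (rule measure_eqI)
    fix A assume "A \<in> sets (distr (PiM I (\<lambda>_. gauss)) (PiM I (\<lambda>_. gauss)) (reflect2 a b c s))"
    then have A[measurable]: "A \<in> sets (PiM I (\<lambda>_. gauss))" by simp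
    have "emeasure (distr (PiM I (\<lambda>_. gauss)) (PiM I (\<lambda>_. gauss)) (reflect2 a b c s)) A
        = (\<integral>\<^sup>+x. indicator A x \<partial>distr (PiM I (\<lambda>_. gauss)) (PiM I (\<lambda>_. gauss)) (reflect2 a b c s))"
      using A by simp
    also have "\<dots> = (\<integral>\<^sup>+x. indicator A (reflect2 a b c s x) \<partial>PiM I (\<lambda>_. gauss))"
      using R by (intro nn_integral_distr) auto
    also have "\<dots> = emeasure (PiM I (\<lambda>_. gauss)) A"
      by (subst key) auto
    finally show "emeasure (distr (PiM I (\<lambda>_. gauss)) (PiM I (\<lambda>_. gauss)) (reflect2 a b c s)) A = emeasure (PiM I (\<lambda>_. gauss)) A" .
  qed simp
qed

text \<open>With \<open>r\<close> the number of rows, this is right multiplication of the matrix by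
  the reflection. It goes row by row because each row is one application of
  \<open>distr_reflect2\<close>.\<close>

fun reflect_cols :: "nat \<Rightarrow> nat \<Rightarrow> nat \<Rightarrow> real \<Rightarrow> real \<Rightarrow> (nat \<times> nat \<Rightarrow> real) \<Rightarrow> nat \<times> nat \<Rightarrow> real" where
  "reflect_cols 0 a b c s Z = Z"
| "reflect_cols (Suc r) a b c s Z = reflect2 (r, a) (r, b) c s (reflect_cols r a b c s Z)"

lemma distr_reflect_cols:
  assumes "r \<le> k" "a < m" "b < m" "a \<noteq> b" "c\<^sup>2 + s\<^sup>2 = 1"
  shows "reflect_cols r a b c s \<in> gauss_mat k m \<rightarrow>\<^sub>M gauss_mat k m \<and>
    distr (gauss_mat k m) (gauss_mat k m) (reflect_cols r a b c s) = gauss_mat k m"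
  using assms(1)
proof (induction r)
  case 0
  have "reflect_cols 0 a b c s = (\<lambda>Z. Z)" by auto
  then show ?case by (simp add: distr_id2)
next
  case (Suc r)
  let ?P = "gauss_mat k m"
  have eq: "reflect_cols (Suc r) a b c s = reflect2 (r, a) (r, b) c s \<circ> reflect_cols r a b c s"
    by auto
  have IH: "reflect_cols r a b c s \<in> ?P \<rightarrow>\<^sub>M ?P" "distr ?P ?P (reflect_cols r a b c s) = ?P"
    using Suc by auto
  have R: "reflect2 (r, a) (r, b) c s \<in> ?P \<rightarrow>\<^sub>M ?P"
    unfolding gauss_mat_def using assms Suc.prems by (intro reflect2_measurable) auto
  have "distr ?P ?P (reflect2 (r, a) (r, b) c s) = ?P"
    unfolding gauss_mat_def using assms Suc.prems by (intro distr_reflect2) auto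
  then have "distr (distr ?P ?P (reflect_cols r a b c s)) ?P (reflect2 (r, a) (r, b) c s) = ?P"
    using IH by simp
  then have "distr ?P ?P (reflect2 (r, a) (r, b) c s \<circ> reflect_cols r a b c s) = ?P"
    by (subst (asm) distr_distr[OF R IH(1)])
  then show ?case
    unfolding eq using IH(1) R by (blast intro: measurable_comp)
qed

lemma reflect_cols_apply:
  assumes "a \<noteq> b"
  shows "reflect_cols r a b c s Z (i, j) =
    (if i < r then reflect2 a b c s (\<lambda>j. Z (i, j)) j else Z (i, j))"
  using assms by (induction r arbitrary: i j) (auto simp: reflect2_def less_Suc_eq)

lemma ip_reflect2_left:
  assumes "a < m" "b < m" "a \<noteq> b"
  shows "ip m (reflect2 a b c s x) y = ip m x (reflect2 a b c s y)"
proof -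
  define J where "J = {..<m} - {a, b}"
  have J: "{..<m} = insert a (insert b J)" "finite J" "a \<notin> insert b J" "b \<notin> J"
    using assms by (auto simp: J_def)
  have "(\<Sum>i\<in>J. reflect2 a b c s x i * y i) = (\<Sum>i\<in>J. x i * reflect2 a b c s y i)"
    by (intro sum.cong) (auto simp: reflect2_def J_def)
  then show ?thesis
    using J assms by (simp add: ip_def reflect2_def algebra_simps)
qed

lemma reflect2_reflect2:
  assumes "a \<noteq> b" "c\<^sup>2 + s\<^sup>2 = 1"
  shows "reflect2 a b c s (reflect2 a b c s x) = x"
proof -
  have *: "c * (c * p + s * q) + s * (s * p - c * q) = p" "s * (c * p + s * q) - c * (s * p - c * q) = q" for p q
  proof -
    have "c * (c * p + s * q) + s * (s * p - c * q) = (c\<^sup>2 + s\<^sup>2) * p" "s * (c * p + s * q) - c * (s * p - c * q) = (c\<^sup>2 + s\<^sup>2) * q"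
      by (simp_all add: algebra_simps power2_eq_square)
    then show "c * (c * p + s * q) + s * (s * p - c * q) = p" "s * (c * p + s * q) - c * (s * p - c * q) = q"
      using assms by simp_all
  qed
  show ?thesis
    using assms by (auto simp: reflect2_def fun_eq_iff *)
qed

lemma ip_reflect2:
  assumes "a < m" "b < m" "a \<noteq> b" "c\<^sup>2 + s\<^sup>2 = 1"
  shows "ip m (reflect2 a b c s x) (reflect2 a b c s y) = ip m x y"
  using assms by (simp add: ip_reflect2_left reflect2_reflect2)

text \<open>The reflection is self-adjoint, so it moves from the rows of \<open>Z\<close> to the
  vector.\<close>

lemma matvec_reflect_cols:
  assumes "a < m" "b < m" "a \<noteq> b" "i < r"
  shows "matvec m (reflect_cols r a b c s Z) x i = matvec m Z (reflect2 a b c s x) i"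
proof -
  have "matvec m (reflect_cols r a b c s Z) x i = ip m (reflect2 a b c s (\<lambda>j. Z (i, j))) x"
    using assms by (simp add: matvec_def ip_def reflect_cols_apply)
  also have "\<dots> = matvec m Z (reflect2 a b c s x) i"
    using assms by (simp add: ip_reflect2_left) (simp add: matvec_def ip_def)
  finally show ?thesis .
qed

section \<open>Expected cosine after Gaussian rounding\<close>

definition cos_angle :: "nat \<Rightarrow> (nat \<Rightarrow> real) \<Rightarrow> (nat \<Rightarrow> real) \<Rightarrow> real" where
  "cos_angle k x y = ip k (vnormalize k x) (vnormalize k y)"

lemma cos_angle_cong:
  assumes "\<And>i. i < k \<Longrightarrow> x i = x' i" "\<And>i. i < k \<Longrightarrow> y i = y' i"
  shows "cos_angle k x y = cos_angle k x' y'"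
  using assms by (simp add: cos_angle_def vnormalize_def ip_def)

lemma cos_angle_minus_right: "cos_angle k x (\<lambda>i. - y i) = - cos_angle k x y"
  by (simp add: cos_angle_def vnormalize_def ip_def sum_negf)

lemma ip_self_nonneg: "0 \<le> ip k x x"
  by (simp add: ip_def sum_nonneg)

text \<open>Only an inequality, since division by zero is 0 and the zero vector normalizes to
  itself. In this form it holds for every \<open>Z\<close>, with no null set to exclude.\<close>

lemma ip_vnormalize_self_le_1: "ip k (vnormalize k x) (vnormalize k x) \<le> 1"
proof -
  have "ip k (vnormalize k x) (vnormalize k x) = ip k x x / ip k x x"
    using ip_self_nonneg[of k x] by (simp add: vnormalize_def ip_def[of _ "\<lambda>i. _ i / _"])
      (simp add: ip_def flip: sum_divide_distrib)
  then show ?thesis by simp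
qed

lemma abs_ip_le: "\<bar>ip k x y\<bar> \<le> (ip k x x + ip k y y) / 2"
proof -
  have "\<bar>x i * y i\<bar> \<le> (x i * x i + y i * y i) / 2" for i
    using sum_squares_bound[of "\<bar>x i\<bar>" "\<bar>y i\<bar>"] by (simp add: abs_mult power2_eq_square)
  then have "\<bar>ip k x y\<bar> \<le> (\<Sum>i<k. (x i * x i + y i * y i) / 2)"
    unfolding ip_def by (intro order_trans[OF sum_abs] sum_mono)
  then show ?thesis
    by (simp add: ip_def sum.distrib add_divide_distrib sum_divide_distrib)
qed

lemma abs_cos_angle_le_1: "\<bar>cos_angle k x y\<bar> \<le> 1"
  using abs_ip_le[of k "vnormalize k x" "vnormalize k y"]
    ip_vnormalize_self_le_1[of k x] ip_vnormalize_self_le_1[of k y]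
  by (simp add: cos_angle_def)

lemma prob_space_gauss_mat: "prob_space (gauss_mat k m)"
  unfolding gauss_mat_def by (intro prob_space_PiM prob_space_gauss)

lemma matvec_measurable:
  assumes "i < k"
  shows "(\<lambda>Z. matvec m Z u i) \<in> borel_measurable (gauss_mat k m)"
proof -
  have "(\<lambda>Z. Z (i, j)) \<in> borel_measurable (gauss_mat k m)" if "j < m" for j
    using measurable_component_singleton[of "(i, j)" "{..<k} \<times> {..<m}" "\<lambda>_. gauss"] assms that
    by (simp add: gauss_mat_def)
  then show ?thesis
    unfolding matvec_def by (intro borel_measurable_sum borel_measurable_times) auto
qed

lemma cos_angle_measurable:
  "(\<lambda>Z. cos_angle k (matvec m Z u) (matvec m Z v)) \<in> borel_measurable (gauss_mat k m)"
  unfolding cos_angle_def ip_def vnormalize_def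
  by (intro borel_measurable_sum borel_measurable_times borel_measurable_divide
      measurable_compose[OF _ borel_measurable_sqrt] matvec_measurable) auto

lemma cos_angle_integrable:
  "integrable (gauss_mat k m) (\<lambda>Z. cos_angle k (matvec m Z u) (matvec m Z v))"
proof -
  interpret prob_space "gauss_mat k m" by (rule prob_space_gauss_mat)
  show ?thesis
    by (rule integrable_const_bound[where B=1])
      (use cos_angle_measurable in \<open>auto simp: abs_cos_angle_le_1\<close>)
qed

definition rounded_corr :: "nat \<Rightarrow> nat \<Rightarrow> (nat \<Rightarrow> real) \<Rightarrow> (nat \<Rightarrow> real) \<Rightarrow> real" where
  "rounded_corr k m u v = (LINT Z | gauss_mat k m. cos_angle k (matvec m Z u) (matvec m Z v))"

lemma Fstar_eq_rounded_corr:
  "Fstar k \<rho> = rounded_corr k 2 (\<lambda>i. if i = 0 then 1 else 0)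
     (\<lambda>i. if i = 0 then \<rho> else if i = 1 then sqrt (1 - \<rho>\<^sup>2) else 0)"
  by (simp add: Fstar_def rounded_corr_def cos_angle_def)

text \<open>Reflecting both vectors amounts to reflecting the columns of \<open>Z\<close>, which
  leaves its law unchanged.\<close>

lemma rounded_corr_reflect2:
  assumes "a < m" "b < m" "a \<noteq> b" "c\<^sup>2 + s\<^sup>2 = 1"
  shows "rounded_corr k m (reflect2 a b c s u) (reflect2 a b c s v) = rounded_corr k m u v"
proof -
  let ?P = "gauss_mat k m" and ?R = "reflect_cols k a b c s"
  have R: "?R \<in> ?P \<rightarrow>\<^sub>M ?P" "distr ?P ?P ?R = ?P"
    using distr_reflect_cols[of k k a m b c s] assms by auto
  have "rounded_corr k m u v = (LINT Z | distr ?P ?P ?R. cos_angle k (matvec m Z u) (matvec m Z v))"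
    by (simp add: R rounded_corr_def)
  also have "\<dots> = (LINT Z | ?P. cos_angle k (matvec m (?R Z) u) (matvec m (?R Z) v))"
    by (intro integral_distr R cos_angle_measurable)
  also have "\<dots> = rounded_corr k m (reflect2 a b c s u) (reflect2 a b c s v)"
    unfolding rounded_corr_def using assms
    by (intro Bochner_Integration.integral_cong cos_angle_cong) (simp_all add: matvec_reflect_cols)
  finally show ?thesis by simp
qed

lemma rounded_corr_cong:
  assumes "\<And>i. i < m \<Longrightarrow> u i = u' i" "\<And>i. i < m \<Longrightarrow> v i = v' i"
  shows "rounded_corr k m u v = rounded_corr k m u' v'"
proof -
  have "matvec m Z u = matvec m Z u'" "matvec m Z v = matvec m Z v'" for Z
    using assms by (auto simp: matvec_def fun_eq_iff)
  then show ?thesis by (simp add: rounded_corr_def)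
qed

text \<open>Columns from \<open>n\<close> on are multiplied by zero, and the remaining columns are
  again a Gaussian matrix, as a marginal of the product measure.\<close>

lemma rounded_corr_restrict:
  assumes nm: "n \<le> m" and 0: "\<And>i. n \<le> i \<Longrightarrow> i < m \<Longrightarrow> u i = 0" "\<And>i. n \<le> i \<Longrightarrow> i < m \<Longrightarrow> v i = 0"
  shows "rounded_corr k m u v = rounded_corr k n u v"
proof -
  interpret prob_space gauss by (rule prob_space_gauss)
  interpret product_prob_space "\<lambda>_. gauss" "{..<k} \<times> {..<m}" by unfold_locales
  let ?R = "\<lambda>Z. restrict Z ({..<k} \<times> {..<n})"
  have R: "?R \<in> gauss_mat k m \<rightarrow>\<^sub>M gauss_mat k n"
    unfolding gauss_mat_def using nm by (intro measurable_restrict_subset) auto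
  have D: "gauss_mat k n = distr (gauss_mat k m) (gauss_mat k n) ?R"
    unfolding gauss_mat_def using nm by (intro distr_restrict) auto
  have mv: "matvec n (?R Z) x i = matvec m Z x i"
    if "i < k" "\<And>j. n \<le> j \<Longrightarrow> j < m \<Longrightarrow> x j = 0" for Z x i
  proof -
    have "matvec n (?R Z) x i = (\<Sum>j<n. Z (i, j) * x j)"
      using that by (simp add: matvec_def)
    also have "\<dots> = (\<Sum>j<m. Z (i, j) * x j)"
      using nm that by (intro sum.mono_neutral_left) auto
    finally show ?thesis by (simp add: matvec_def)
  qed
  have "rounded_corr k n u v = (LINT Z | distr (gauss_mat k m) (gauss_mat k n) ?R. cos_angle k (matvec n Z u) (matvec n Z v))"
    by (simp add: rounded_corr_def D[symmetric])
  also have "\<dots> = (LINT Z | gauss_mat k m. cos_angle k (matvec n (?R Z) u) (matvec n (?R Z) v))"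
    by (intro integral_distr R cos_angle_measurable)
  also have "\<dots> = rounded_corr k m u v"
    unfolding rounded_corr_def
    by (intro Bochner_Integration.integral_cong refl cos_angle_cong mv 0)
  finally show ?thesis by simp
qed

lemma reflection_onto_axis:
  fixes x y :: real
  obtains c s where "c\<^sup>2 + s\<^sup>2 = 1" "s * x - c * y = 0" "c * x + s * y \<ge> 0"
proof (cases "x = 0 \<and> y = 0")
  case True
  then show ?thesis by (intro that[of 1 0]) auto
next
  case False
  define r where "r = sqrt (x\<^sup>2 + y\<^sup>2)"
  have r: "r > 0" "r\<^sup>2 = x\<^sup>2 + y\<^sup>2"
    using False by (auto simp: r_def sum_power2_gt_zero_iff)
  have "(x / r)\<^sup>2 + (y / r)\<^sup>2 = 1"
    using r False by (simp add: power_divide flip: add_divide_distrib)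
  moreover have "x / r * x + y / r * y = r\<^sup>2 / r"
    using r(2) by (simp add: power2_eq_square add_divide_distrib)
  ultimately show ?thesis
    using r by (intro that[of "x / r" "y / r"]) (auto simp: mult.commute)
qed

text \<open>Successive reflections move \<open>u\<close> onto the first axis and then \<open>v\<close> into the plane of the
  first two axes, where the pair is the one in the definition of \<open>Fstar\<close>.\<close>

lemma rounded_corr_eliminate_left:
  assumes "n < m"
  shows "\<exists>u' v'. rounded_corr k m u' v' = rounded_corr k m u v \<and>
    ip m u' u' = ip m u u \<and> ip m u' v' = ip m u v \<and> ip m v' v' = ip m v v \<and>
    (\<forall>j\<in>{1..n}. u' j = 0) \<and> (n > 0 \<longrightarrow> u' 0 \<ge> 0)"
  using assms
proof (induction n)
  case 0
  then show ?case by auto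
next
  case (Suc n)
  then obtain u' v' where IH: "rounded_corr k m u' v' = rounded_corr k m u v"
      "ip m u' u' = ip m u u" "ip m u' v' = ip m u v" "ip m v' v' = ip m v v"
      "\<And>j. j \<in> {1..n} \<Longrightarrow> u' j = 0" by force
  \<comment> \<open>This reflection clears entry \<open>Suc n\<close>, keeps the entries already
    cleared, and makes entry 0 nonnegative. The sign is thus known only after at least one
    reflection.\<close>
  obtain c s where cs: "c\<^sup>2 + s\<^sup>2 = 1" "s * u' 0 - c * u' (Suc n) = 0" "c * u' 0 + s * u' (Suc n) \<ge> 0"
    using reflection_onto_axis .
  show ?case
    using Suc.prems cs IH
    by (intro exI[of _ "reflect2 0 (Suc n) c s u'"] exI[of _ "reflect2 0 (Suc n) c s v'"])
      (auto simp: rounded_corr_reflect2 ip_reflect2, auto simp: reflect2_def)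
qed

lemma rounded_corr_eliminate_right:
  assumes "n + 1 < m" and u: "\<And>j. 0 < j \<Longrightarrow> j < m \<Longrightarrow> u j = 0"
  shows "\<exists>v'. rounded_corr k m u v' = rounded_corr k m u v \<and>
    ip m u v' = ip m u v \<and> ip m v' v' = ip m v v \<and>
    (\<forall>j\<in>{2..n + 1}. v' j = 0) \<and> (n > 0 \<longrightarrow> v' 1 \<ge> 0)"
  using assms(1)
proof (induction n)
  case 0
  then show ?case by auto
next
  case (Suc n)
  then obtain v' where IH: "rounded_corr k m u v' = rounded_corr k m u v"
      "ip m u v' = ip m u v" "ip m v' v' = ip m v v"
      "\<And>j. j \<in> {2..n + 1} \<Longrightarrow> v' j = 0" by force
  obtain c s where cs: "c\<^sup>2 + s\<^sup>2 = 1" "s * v' 1 - c * v' (n + 2) = 0" "c * v' 1 + s * v' (n + 2) \<ge> 0"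
    using reflection_onto_axis .
  let ?R = "reflect2 1 (n + 2) c s"
  \<comment> \<open>Both reflected axes avoid axis 0, the only one on which \<open>u\<close> may be
    nonzero.\<close>
  have Ru: "?R u = u"
    using u[of 1] u[of "n + 2"] Suc.prems by (auto simp: reflect2_def fun_eq_iff)
  have "rounded_corr k m u (?R v') = rounded_corr k m u v'" "ip m u (?R v') = ip m u v'"
     "ip m (?R v') (?R v') = ip m v' v'"
    using rounded_corr_reflect2[of 1 m "n + 2" c s k u v'] ip_reflect2[of 1 m "n + 2" c s]
      Suc.prems cs Ru by (auto, metis)
  moreover have "\<forall>j\<in>{2..Suc n + 1}. ?R v' j = 0" "?R v' 1 \<ge> 0"
    using cs IH(4) by (auto simp: reflect2_def)
  ultimately show ?case
    using IH by (intro exI[of _ "?R v'"]) simp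
qed

text \<open>Inner products survive the eliminations, so they determine the reduced pair up to signs,
  and the signs come from the last reflections. With \<open>m \<ge> 3\<close> at least one
  reflection acts on \<open>v\<close> and fixes the sign of its entry 1.\<close>

lemma rounded_corr_eq_Fstar:
  assumes m: "m \<ge> 3" and uv: "unitv m u" "unitv m v"
  shows "rounded_corr k m u v = Fstar k (ip m u v)"
proof -
  obtain u' v' where 1: "rounded_corr k m u' v' = rounded_corr k m u v"
    "ip m u' u' = 1" "ip m u' v' = ip m u v" "ip m v' v' = 1"
    "\<And>j. j \<in> {1..m - 1} \<Longrightarrow> u' j = 0" "u' 0 \<ge> 0"
    using rounded_corr_eliminate_left[of "m - 1" m k u v] m uv by (auto simp: unitv_def)
  have u'j: "u' j = 0" if "0 < j" "j < m" for j using 1(5) that by auto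
  have "Suc (m - 2) = m - Suc 0" using m by simp
  then obtain v'' where 2: "rounded_corr k m u' v'' = rounded_corr k m u v"
    "ip m u' v'' = ip m u v" "ip m v'' v'' = 1"
    "\<And>j. j \<in> {2..m - 1} \<Longrightarrow> v'' j = 0" "v'' 1 \<ge> 0"
    using rounded_corr_eliminate_right[of "m - 2" m u' k v'] m 1 u'j by auto
  have v''j: "v'' j = 0" if "2 \<le> j" "j < m" for j using 2(4) that by auto
  have split2: "ip m x y = x 0 * y 0 + x 1 * y 1" if "\<And>j. 2 \<le> j \<Longrightarrow> j < m \<Longrightarrow> y j = 0" for x y
  proof -
    have "ip m x y = (\<Sum>j\<in>{0, 1}. x j * y j)"
      unfolding ip_def using m that by (intro sum.mono_neutral_right) auto
    then show ?thesis by simp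
  qed
  have "u' 0 * u' 0 = 1" using split2[of u' u'] 1(2) u'j m by simp
  then have u0: "u' 0 = 1" using 1(6) by (metis abs_of_nonneg abs_square_eq_1 power2_eq_square)
  have v0: "v'' 0 = ip m u v" using split2[of v'' u'] 2(2) u0 u'j v''j m by simp
  have "(v'' 0)\<^sup>2 + (v'' 1)\<^sup>2 = 1" using split2[of v'' v''] 2(3) v''j by (simp add: power2_eq_square)
  then have "(v'' 1)\<^sup>2 = 1 - (ip m u v)\<^sup>2" using v0 by simp
  then have v1: "v'' 1 = sqrt (1 - (ip m u v)\<^sup>2)"
    using 2(5) by (metis real_sqrt_unique)
  have "rounded_corr k m u v = rounded_corr k 2 u' v''"
    using rounded_corr_restrict[of 2 m u' v'' k] 2(1) u'j v''j m by auto
  also have "\<dots> = Fstar k (ip m u v)"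
    unfolding Fstar_eq_rounded_corr
    by (intro rounded_corr_cong) (use u0 v0 v1 u'j m in \<open>auto simp: less_2_cases_iff\<close>)
  finally show ?thesis .
qed

text \<open>Negating the second vector negates every cosine. The negated vector has a nonpositive
  entry 1, so it is not the normal form in \<open>Fstar\<close>; it is identified through
  \<open>rounded_corr_eq_Fstar\<close> in dimension 3.\<close>

lemma Fstar_minus:
  assumes "\<bar>\<rho>\<bar> \<le> 1"
  shows "Fstar k (- \<rho>) = - Fstar k \<rho>"
proof -
  let ?u = "\<lambda>i::nat. if i = 0 then 1 else 0 :: real"
  let ?v = "\<lambda>i::nat. if i = 0 then \<rho> else if i = 1 then sqrt (1 - \<rho>\<^sup>2) else 0"
  have "\<rho>\<^sup>2 \<le> 1" using assms by (simp add: abs_square_le_1)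
  then have u: "unitv 3 ?u" "unitv 3 ?v" "unitv 3 (\<lambda>i. - ?v i)"
      "ip 3 ?u ?v = \<rho>" "ip 3 ?u (\<lambda>i. - ?v i) = - \<rho>"
    by (auto simp: unitv_def ip_def numeral_3_eq_3 power2_eq_square)
  have "matvec 3 Z (\<lambda>i. - ?v i) = (\<lambda>i. - matvec 3 Z ?v i)" for Z
    unfolding matvec_def by (simp add: sum_negf)
  then have "rounded_corr k 3 ?u (\<lambda>i. - ?v i) = - rounded_corr k 3 ?u ?v"
    unfolding rounded_corr_def by (simp add: cos_angle_minus_right)
  then show ?thesis
    using rounded_corr_eq_Fstar[of 3 ?u ?v k] rounded_corr_eq_Fstar[of 3 ?u "\<lambda>i. - ?v i" k] u by simp
qed

section \<open>Boundedness and continuity of \<open>Fstar\<close>\<close>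

lemma abs_Fstar_le_1: "\<bar>Fstar k \<rho>\<bar> \<le> 1"
proof -
  interpret prob_space "gauss_mat k 2" by (rule prob_space_gauss_mat)
  let ?X = "\<lambda>Z. cos_angle k (matvec 2 Z (\<lambda>i. if i = 0 then 1 else 0))
     (matvec 2 Z (\<lambda>i. if i = 0 then \<rho> else if i = 1 then sqrt (1 - \<rho>\<^sup>2) else 0))"
  have "expectation ?X \<le> 1" "expectation ?X \<ge> -1"
    using abs_cos_angle_le_1
    by (auto intro!: integral_le_const integral_ge_const cos_angle_integrable simp: abs_le_iff minus_le_iff)
  then show ?thesis
    by (simp add: Fstar_eq_rounded_corr rounded_corr_def)
qed

text \<open>A reflection turns this combination of entries into a single standard Gaussian, which
  has no atom at 0.\<close>

lemma AE_gauss_mat_nonzero: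
  assumes "k > 0" "c\<^sup>2 + s\<^sup>2 = 1"
  shows "AE Z in gauss_mat k 2. c * Z (0, 0) + s * Z (0, 1) \<noteq> 0"
proof -
  let ?P = "gauss_mat k 2" and ?R = "reflect2 (0::nat, 0::nat) (0, 1) c s"
  have "AE x in gauss. x \<noteq> 0"
    using AE_lborel_singleton[of 0] by (auto simp: AE_density elim: eventually_mono)
  then have "AE Z in ?P. Z (0, 0) \<noteq> 0"
    unfolding gauss_mat_def using assms by (intro AE_PiM_component prob_space_gauss) auto
  moreover have D: "distr ?P ?P ?R = ?P"
    unfolding gauss_mat_def using assms by (intro distr_reflect2) auto
  ultimately have "AE Z in distr ?P ?P ?R. Z (0, 0) \<noteq> 0" unfolding D by simp
  moreover have "?R \<in> ?P \<rightarrow>\<^sub>M ?P"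
    unfolding gauss_mat_def using assms by (intro reflect2_measurable) auto
  ultimately have "AE Z in ?P. ?R Z (0, 0) \<noteq> 0"
    by (rule AE_distrD[rotated])
  then show ?thesis by (simp add: reflect2_def)
qed

lemma tendsto_cos_angle:
  assumes "\<And>i. i < k \<Longrightarrow> ((\<lambda>n. y n i) \<longlongrightarrow> z i) F" "ip k z z \<noteq> 0"
  shows "((\<lambda>n. cos_angle k x (y n)) \<longlongrightarrow> cos_angle k x z) F"
proof -
  have "((\<lambda>n. ip k (y n) (y n)) \<longlongrightarrow> ip k z z) F"
    unfolding ip_def using assms by (intro tendsto_sum tendsto_mult) auto
  then show ?thesis
    unfolding cos_angle_def vnormalize_def ip_def[of _ "\<lambda>i. _ i / _"] using assms
    by (intro tendsto_sum tendsto_mult tendsto_divide tendsto_real_sqrt tendsto_const) auto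
qed

text \<open>Dominated convergence: the cosine is bounded by 1 and converges unless the limit vector
  is mapped to 0 by \<open>Z\<close>, which has probability zero because its first entry is almost
  surely nonzero.\<close>

lemma continuous_on_Fstar:
  assumes "k > 0"
  shows "continuous_on {-1..1} (Fstar k)"
proof (rule continuous_on_sequentiallyI)
  fix r :: "nat \<Rightarrow> real" and \<rho> assume r: "\<forall>n. r n \<in> {-1..1}" "\<rho> \<in> {-1..1}" "r \<longlonglongrightarrow> \<rho>"
  interpret prob_space "gauss_mat k 2" by (rule prob_space_gauss_mat)
  let ?u = "\<lambda>i::nat. if i = 0 then 1 else 0 :: real"
  define v where "v \<rho> i = (if i = 0 then \<rho> else if i = 1 then sqrt (1 - \<rho>\<^sup>2) else 0)" for \<rho> :: real and i :: nat
  have F: "Fstar k \<rho> = (LINT Z | gauss_mat k 2. cos_angle k (matvec 2 Z ?u) (matvec 2 Z (v \<rho>)))" for \<rho>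
    by (simp add: Fstar_eq_rounded_corr rounded_corr_def v_def[abs_def])
  have "\<rho>\<^sup>2 \<le> 1" using r by (simp add: abs_square_le_1 abs_le_iff)
  then have "\<rho>\<^sup>2 + (sqrt (1 - \<rho>\<^sup>2))\<^sup>2 = 1" by simp
  then have "AE Z in gauss_mat k 2. \<rho> * Z (0, 0) + sqrt (1 - \<rho>\<^sup>2) * Z (0, 1) \<noteq> 0"
    by (intro AE_gauss_mat_nonzero assms)
  then have AE: "AE Z in gauss_mat k 2. (\<lambda>n. cos_angle k (matvec 2 Z ?u) (matvec 2 Z (v (r n))))
      \<longlonglongrightarrow> cos_angle k (matvec 2 Z ?u) (matvec 2 Z (v \<rho>))"
  proof eventually_elim
    case (elim Z)
    then have nz: "matvec 2 Z (v \<rho>) 0 \<noteq> 0"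
      by (simp add: matvec_def v_def numeral_2_eq_2 mult.commute)
    have "(matvec 2 Z (v \<rho>) 0)\<^sup>2 \<le> ip k (matvec 2 Z (v \<rho>)) (matvec 2 Z (v \<rho>))"
      unfolding ip_def power2_eq_square using assms by (intro member_le_sum) auto
    then have "ip k (matvec 2 Z (v \<rho>)) (matvec 2 Z (v \<rho>)) \<noteq> 0"
      using nz by auto
    moreover have "(\<lambda>n. v (r n) j) \<longlonglongrightarrow> v \<rho> j" for j
      unfolding v_def using r(3) by (auto intro!: tendsto_intros)
    then have "(\<lambda>n. matvec 2 Z (v (r n)) i) \<longlonglongrightarrow> matvec 2 Z (v \<rho>) i" for i
      unfolding matvec_def by (intro tendsto_intros)
    ultimately show ?case by (intro tendsto_cos_angle)
  qed
  have "(\<lambda>n. Fstar k (r n)) \<longlonglongrightarrow> Fstar k \<rho>"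
    unfolding F
    by (rule integral_dominated_convergence[where w="\<lambda>_. 1"])
      (use AE abs_cos_angle_le_1 in \<open>auto intro!: cos_angle_measurable\<close>)
  then show "(\<lambda>n. Fstar k (r n)) \<longlonglongrightarrow> Fstar k \<rho>" .
qed

section \<open>The noisy hypercube\<close>

text \<open>Splits sums over the cube by the lowest binary digit, the coordinate peeled off in the
  inductions on \<open>n\<close>.\<close>

lemma sum_lessThan_double:
  fixes f :: "nat \<Rightarrow> 'a::comm_monoid_add"
  shows "(\<Sum>i<2 * n. f i) = (\<Sum>i<n. f (2 * i) + f (2 * i + 1))"
  by (induction n) (simp_all add: ac_simps)

section \<open>Linearity and monotonicity of the edge expectation\<close>

lemma edge_exp_add: "edge_exp N w (\<lambda>u v. g u v + h u v) = edge_exp N w g + edge_exp N w h"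
  by (simp add: edge_exp_def sum.distrib distrib_left)

lemma edge_exp_diff: "edge_exp N w (\<lambda>u v. g u v - h u v) = edge_exp N w g - edge_exp N w h"
  by (simp add: edge_exp_def sum_subtractf right_diff_distrib)

lemma edge_exp_cmult: "edge_exp N w (\<lambda>u v. c * g u v) = c * edge_exp N w g"
  by (simp add: edge_exp_def sum_distrib_left mult.left_commute)

lemma edge_exp_divide: "edge_exp N w (\<lambda>u v. g u v / c) = edge_exp N w g / c"
  by (simp add: edge_exp_def sum_divide_distrib)

lemma edge_exp_sum: "edge_exp N w (\<lambda>u v. \<Sum>i\<in>I. g i u v) = (\<Sum>i\<in>I. edge_exp N w (g i))"
proof -
  have "edge_exp N w (\<lambda>u v. \<Sum>i\<in>I. g i u v) = (\<Sum>u<N. \<Sum>i\<in>I. \<Sum>v<N. w u v * g i u v)"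
    unfolding edge_exp_def sum_distrib_left by (intro sum.cong refl sum.swap)
  also have "\<dots> = (\<Sum>i\<in>I. edge_exp N w (g i))"
    unfolding edge_exp_def by (rule sum.swap)
  finally show ?thesis .
qed

lemma edge_exp_mono:
  assumes "\<And>u v. 0 \<le> w u v" "\<And>u v. u < N \<Longrightarrow> v < N \<Longrightarrow> g u v \<le> h u v"
  shows "edge_exp N w g \<le> edge_exp N w h"
  unfolding edge_exp_def using assms by (intro sum_mono mult_left_mono) auto

text \<open>A vertex of the cube \<open>{-1, 1}\<^sup>n\<close> is a number \<open>u < 2\<^sup>n\<close>, its \<open>i\<close>-th coordinate being
  \<open>(-1)\<close> to the \<open>i\<close>-th binary digit of \<open>u\<close>. Then \<open>cube_w \<rho> n u v\<close> is the joint law of a uniform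
  point and a copy whose coordinates are independently \<open>\<rho>\<close>-correlated with it.\<close>

fun cube_w :: "real \<Rightarrow> nat \<Rightarrow> nat \<Rightarrow> nat \<Rightarrow> real" where
  "cube_w \<rho> 0 u v = 1"
| "cube_w \<rho> (Suc n) u v = (1 + \<rho> * ((-1) ^ u * (-1) ^ v)) / 4 * cube_w \<rho> n (u div 2) (v div 2)"

definition cube_ip :: "nat \<Rightarrow> nat \<Rightarrow> nat \<Rightarrow> real" where
  "cube_ip n u v = (\<Sum>i<n. (-1) ^ (u div 2 ^ i) * (-1) ^ (v div 2 ^ i))"

lemma cube_ip_Suc: "cube_ip (Suc n) u v = (-1) ^ u * (-1) ^ v + cube_ip n (u div 2) (v div 2)"
  by (simp add: cube_ip_def sum.lessThan_Suc_shift div_mult2_eq del: sum.lessThan_Suc)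

lemma cube_ip_self: "cube_ip n u u = n"
  by (simp add: cube_ip_def flip: power_add)

lemma abs_cube_ip_le: "\<bar>cube_ip n u v\<bar> \<le> n"
proof -
  have "\<bar>cube_ip n u v\<bar> \<le> (\<Sum>i<n. \<bar>(-1) ^ (u div 2 ^ i) * (-1) ^ (v div 2 ^ i) :: real\<bar>)"
    unfolding cube_ip_def by (rule sum_abs)
  then show ?thesis by (simp add: abs_mult power_abs)
qed

section \<open>Mass and moments of the correlated pair\<close>

lemma cube_w_nonneg:
  assumes "\<bar>\<rho>\<bar> \<le> 1"
  shows "0 \<le> cube_w \<rho> n u v"
proof (induction n arbitrary: u v)
  case (Suc n)
  have "(-1::real) ^ u * (-1) ^ v \<in> {1, -1}"
    by (cases "even u"; cases "even v") auto
  then have "0 \<le> 1 + \<rho> * ((-1) ^ u * (-1) ^ v)"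
    using assms by auto
  then show ?case using Suc by simp
qed simp

lemma cube_w_diag: "(\<Sum>u<2 ^ n. cube_w \<rho> n u u) = ((1 + \<rho>) / 2) ^ n"
proof (induction n)
  case (Suc n)
  have "(\<Sum>u<2 ^ Suc n. cube_w \<rho> (Suc n) u u) = (\<Sum>u<2 ^ n. (1 + \<rho>) / 2 * cube_w \<rho> n u u)"
    unfolding power_Suc sum_lessThan_double by (intro sum.cong refl) (simp add: field_simps)
  also have "\<dots> = (1 + \<rho>) / 2 * (\<Sum>u<2 ^ n. cube_w \<rho> n u u)"
    by (rule sum_distrib_left[symmetric])
  finally show ?case using Suc by simp
qed simp

text \<open>Conditions on the lowest digits of the two ends: each agreeing pair has weight
  \<open>(1 + \<rho>) / 4\<close>, each differing pair \<open>(1 - \<rho>) / 4\<close>. The moments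
  and the spectral bounds follow from this recursion.\<close>

lemma edge_exp_cube_Suc:
  "edge_exp (2 ^ Suc n) (cube_w \<rho> (Suc n)) g = edge_exp (2 ^ n) (cube_w \<rho> n)
     (\<lambda>u v. (1 + \<rho>) / 4 * (g (2 * u) (2 * v) + g (2 * u + 1) (2 * v + 1)) +
            (1 - \<rho>) / 4 * (g (2 * u) (2 * v + 1) + g (2 * u + 1) (2 * v)))"
  unfolding edge_exp_def power_Suc sum_lessThan_double sum.distrib[symmetric]
  by (intro sum.cong refl) (simp add: algebra_simps add_divide_distrib diff_divide_distrib)

lemma edge_exp_cube_1: "edge_exp (2 ^ n) (cube_w \<rho> n) (\<lambda>u v. 1) = 1"
proof (induction n)
  case (Suc n)
  have "(1 + \<rho>) / 4 * (1 + 1) + (1 - \<rho>) / 4 * (1 + 1) = 1" by (simp add: field_simps)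
  then show ?case unfolding edge_exp_cube_Suc by (simp only: Suc)
qed (simp add: edge_exp_def)

lemma edge_exp_cube_const: "edge_exp (2 ^ n) (cube_w \<rho> n) (\<lambda>u v. c) = c"
  using edge_exp_cmult[of "2 ^ n" "cube_w \<rho> n" c "\<lambda>_ _. 1"] edge_exp_cube_1 by simp

lemma edge_exp_cube_first_bit:
  assumes "n > 0"
  shows "edge_exp (2 ^ n) (cube_w \<rho> n) (\<lambda>u v. (-1) ^ u * (-1) ^ v) = \<rho>"
proof -
  obtain m where n: "n = Suc m" using assms by (cases n) auto
  have "(\<lambda>u v. (1 + \<rho>) / 4 * ((- 1) ^ (2 * u) * (- 1) ^ (2 * v) + (- 1) ^ (2 * u + 1) * (- 1) ^ (2 * v + 1)) +
      (1 - \<rho>) / 4 * ((- 1) ^ (2 * u) * (- 1) ^ (2 * v + 1) + (- 1) ^ (2 * u + 1) * (- 1) ^ (2 * v)))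
      = (\<lambda>u v :: nat. \<rho>)"
    by (auto simp: fun_eq_iff field_simps)
  then show ?thesis
    unfolding n edge_exp_cube_Suc by (simp only: edge_exp_cube_const)
qed

lemma edge_exp_cube_ip: "edge_exp (2 ^ n) (cube_w \<rho> n) (cube_ip n) = n * \<rho>"
proof (induction n)
  case 0
  then show ?case by (simp add: edge_exp_def cube_ip_def)
next
  case (Suc n)
  have "edge_exp (2 ^ Suc n) (cube_w \<rho> (Suc n)) (cube_ip (Suc n))
      = edge_exp (2 ^ n) (cube_w \<rho> n) (\<lambda>u v. \<rho> + cube_ip n u v)"
    unfolding edge_exp_cube_Suc cube_ip_Suc
    by (intro arg_cong[where f="edge_exp _ _"] ext) (simp add: field_simps)
  then show ?case
    using Suc by (simp add: edge_exp_add edge_exp_cube_const algebra_simps del: cube_w.simps)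
qed

text \<open>\<open>cube_ip\<close> is a sum of \<open>n\<close> independent signs of mean \<rho> and
  variance \<open>1 - \<rho>\<^sup>2\<close>; in the induction the cross term vanishes since the new
  sign minus \<rho> has mean zero.\<close>

lemma edge_exp_cube_variance:
  "edge_exp (2 ^ n) (cube_w \<rho> n) (\<lambda>u v. (cube_ip n u v - n * \<rho>)\<^sup>2) = n * (1 - \<rho>\<^sup>2)"
proof (induction n)
  case 0
  then show ?case by (simp add: edge_exp_def cube_ip_def)
next
  case (Suc n)
  have "edge_exp (2 ^ Suc n) (cube_w \<rho> (Suc n)) (\<lambda>u v. (cube_ip (Suc n) u v - Suc n * \<rho>)\<^sup>2)
      = edge_exp (2 ^ n) (cube_w \<rho> n) (\<lambda>u v. (cube_ip n u v - n * \<rho>)\<^sup>2 + (1 - \<rho>\<^sup>2))"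
    unfolding edge_exp_cube_Suc cube_ip_Suc
    by (intro arg_cong[where f="edge_exp _ _"] ext) (simp add: field_simps power2_eq_square)
  also have "\<dots> = n * (1 - \<rho>\<^sup>2) + (1 - \<rho>\<^sup>2)"
    by (simp only: edge_exp_add edge_exp_cube_const Suc)
  also have "\<dots> = Suc n * (1 - \<rho>\<^sup>2)" by (simp add: algebra_simps)
  finally show ?case .
qed

text \<open>Splitting off one coordinate, the form is \<open>Q s + \<rho> * Q d\<close> for the even part \<open>s\<close> and
  the odd part \<open>d\<close>; the upper bound is needed for the negative coefficient of \<open>Q d\<close>.\<close>

lemma cube_form_bounds:
  fixes g :: "nat \<Rightarrow> real"
  assumes \<rho>: "-1 \<le> \<rho>" "\<rho> \<le> 0"
  shows "\<rho> * ((\<Sum>u<2 ^ n. (g u)\<^sup>2) / 2 ^ n) \<le> edge_exp (2 ^ n) (cube_w \<rho> n) (\<lambda>u v. g u * g v) \<and>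
    edge_exp (2 ^ n) (cube_w \<rho> n) (\<lambda>u v. g u * g v) \<le> (\<Sum>u<2 ^ n. (g u)\<^sup>2) / 2 ^ n"
proof (induction n arbitrary: g)
  case 0
  show ?case using \<rho> mult_right_mono[of \<rho> 1 "(g 0)\<^sup>2"] by (simp add: edge_exp_def power2_eq_square)
next
  case (Suc n)
  define s where "s u = (g (2 * u) + g (2 * u + 1)) / 2" for u
  define d where "d u = (g (2 * u) - g (2 * u + 1)) / 2" for u
  let ?E = "edge_exp (2 ^ n) (cube_w \<rho> n)"
  let ?S = "(\<Sum>u<2 ^ n. (s u)\<^sup>2) / 2 ^ n" and ?D = "(\<Sum>u<2 ^ n. (d u)\<^sup>2) / 2 ^ n"
  \<comment> \<open>The values of \<open>g\<close> are \<open>s + d\<close> at even and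
    \<open>s - d\<close> at odd vertices, so the mixed products cancel; the weights of agreeing and
    differing digits leave coefficients 1 and \<rho>.\<close>
  have E: "edge_exp (2 ^ Suc n) (cube_w \<rho> (Suc n)) (\<lambda>u v. g u * g v)
      = ?E (\<lambda>u v. s u * s v) + \<rho> * ?E (\<lambda>u v. d u * d v)"
    unfolding edge_exp_cube_Suc edge_exp_cmult[symmetric] edge_exp_add[symmetric]
    by (rule arg_cong[where f="?E"]) (simp add: fun_eq_iff s_def d_def field_simps)
  have "(\<Sum>u<2 ^ Suc n. (g u)\<^sup>2) = (\<Sum>u<2 ^ n. 2 * ((s u)\<^sup>2 + (d u)\<^sup>2))"
    unfolding power_Suc sum_lessThan_double
    by (intro sum.cong refl) (simp add: s_def d_def field_simps power2_eq_square)
  then have N: "(\<Sum>u<2 ^ Suc n. (g u)\<^sup>2) / 2 ^ Suc n = ?S + ?D"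
    by (simp add: sum.distrib add_divide_distrib flip: sum_distrib_left)
  have D0: "0 \<le> ?D" by (simp add: sum_nonneg)
  have D1: "\<rho> * ?D \<le> \<rho> * ?E (\<lambda>u v. d u * d v)"
    using Suc[of d] \<rho> by (intro mult_left_mono_neg) auto
  \<comment> \<open>Multiplication by \<rho> \<le> 0 turns the lower bound for \<open>d\<close> into
    an upper bound, and \<open>\<rho>\<^sup>2 \<le> 1\<close> finishes it.\<close>
  have "\<rho> * ?E (\<lambda>u v. d u * d v) \<le> \<rho> * (\<rho> * ?D)"
    using Suc[of d] \<rho> by (intro mult_left_mono_neg) auto
  also have "\<dots> \<le> 1 * ?D"
    unfolding mult.assoc[symmetric] using D0 \<rho>
    by (intro mult_right_mono) (simp_all add: abs_square_le_1 flip: power2_eq_square)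
  finally have D2: "\<rho> * ?E (\<lambda>u v. d u * d v) \<le> ?D" by simp
  show ?case
    unfolding E N using Suc[of s] D1 D2 by (simp add: distrib_left)
qed

text \<open>The scalar bound is summed over the coordinates of \<open>g\<close>. Norms below 1 are
  harmless because \<rho> \<le> 0, so the bound also covers normalized vectors that may
  vanish.\<close>

lemma cube_ip_form_ge:
  assumes \<rho>: "-1 \<le> \<rho>" "\<rho> \<le> 0" and g: "\<And>u. u < 2 ^ n \<Longrightarrow> ip d (g u) (g u) \<le> 1"
  shows "\<rho> \<le> edge_exp (2 ^ n) (cube_w \<rho> n) (\<lambda>u v. ip d (g u) (g v))"
proof -
  have "(\<Sum>u<2 ^ n. ip d (g u) (g u)) \<le> (\<Sum>u<(2::nat) ^ n. 1::real)"
    using g by (intro sum_mono) auto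
  then have "\<rho> * 1 \<le> \<rho> * ((\<Sum>u<2 ^ n. ip d (g u) (g u)) / 2 ^ n)"
    using \<rho> by (intro mult_left_mono_neg) auto
  also have "(\<Sum>u<2 ^ n. ip d (g u) (g u)) = (\<Sum>i<d. \<Sum>u<2 ^ n. (g u i)\<^sup>2)"
    unfolding ip_def power2_eq_square by (rule sum.swap)
  also have "\<rho> * (\<dots> / 2 ^ n) = (\<Sum>i<d. \<rho> * ((\<Sum>u<2 ^ n. (g u i)\<^sup>2) / 2 ^ n))"
    by (simp add: sum_divide_distrib sum_distrib_left)
  also have "\<dots> \<le> (\<Sum>i<d. edge_exp (2 ^ n) (cube_w \<rho> n) (\<lambda>u v. g u i * g v i))"
    by (intro sum_mono cube_form_bounds[OF \<rho>, THEN conjunct1])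
  finally show ?thesis by (simp add: ip_def edge_exp_sum)
qed

text \<open>The normalized inner product has mean \<rho> and variance at most \<open>1 / n\<close>,
  hence converges to \<rho> in probability; \<open>F\<close> is bounded and continuous.\<close>

lemma tendsto_edge_exp_cube:
  fixes F :: "real \<Rightarrow> real"
  assumes F: "continuous_on {-1..1} F" "\<And>r. \<bar>F r\<bar> \<le> 1" and \<rho>: "\<bar>\<rho>\<bar> \<le> 1"
  shows "(\<lambda>n. edge_exp (2 ^ n) (cube_w \<rho> n) (\<lambda>u v. F (cube_ip n u v / n))) \<longlonglongrightarrow> F \<rho>"
proof (rule LIMSEQ_I)
  fix e :: real assume e: "e > 0"
  have "\<rho> \<in> {-1..1}" using \<rho> by (auto simp: abs_le_iff)
  with F(1) obtain \<delta> where \<delta>: "\<delta> > 0" "\<And>r. r \<in> {-1..1} \<Longrightarrow> \<bar>r - \<rho>\<bar> < \<delta> \<Longrightarrow> \<bar>F r - F \<rho>\<bar> < e / 2"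
    unfolding continuous_on_iff dist_real_def using e by (meson half_gt_zero)
  \<comment> \<open>Chosen so that the Chebyshev term \<open>2 / (\<delta>\<^sup>2 * n)\<close>
    falls below \<open>e / 2\<close> for \<open>n > M\<close>.\<close>
  obtain M :: nat where M: "4 / (e * \<delta>\<^sup>2) < M"
    using reals_Archimedean2 by blast
  show "\<exists>no. \<forall>n\<ge>no. norm (edge_exp (2 ^ n) (cube_w \<rho> n) (\<lambda>u v. F (cube_ip n u v / n)) - F \<rho>) < e"
  proof (intro exI allI impI)
    fix n assume n: "n \<ge> M + 1"
    let ?E = "edge_exp (2 ^ n) (cube_w \<rho> n)" and ?X = "\<lambda>u v. cube_ip n u v / real n"
    \<comment> \<open>Chebyshev: the quadratic term dominates outside the \<open>\<delta>\<close>-neighbourhood of \<open>\<rho>\<close>.\<close>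
    have pt: "\<bar>F (?X u v) - F \<rho>\<bar> \<le> e / 2 + 2 / \<delta>\<^sup>2 * (?X u v - \<rho>)\<^sup>2" for u v
    proof (cases "\<bar>?X u v - \<rho>\<bar> < \<delta>")
      case True
      have "?X u v \<in> {-1..1}"
        using abs_cube_ip_le[of n u v] n by (auto simp: abs_le_iff divide_le_eq le_divide_eq)
      with True \<delta> have "\<bar>F (?X u v) - F \<rho>\<bar> < e / 2" by blast
      moreover have "0 \<le> 2 / \<delta>\<^sup>2 * (?X u v - \<rho>)\<^sup>2" by simp
      ultimately show ?thesis by linarith
    next
      case False
      then have "\<delta>\<^sup>2 \<le> (?X u v - \<rho>)\<^sup>2"
        using \<delta>(1) by (simp add: abs_le_square_iff[symmetric])
      then have "2 \<le> 2 / \<delta>\<^sup>2 * (?X u v - \<rho>)\<^sup>2"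
        using \<delta>(1) by (simp add: field_simps)
      moreover have "\<bar>F (?X u v) - F \<rho>\<bar> \<le> 2"
        using F(2)[of "?X u v"] F(2)[of \<rho>] by linarith
      ultimately show ?thesis using e by linarith
    qed
    have "(?X u v - \<rho>)\<^sup>2 = (cube_ip n u v - n * \<rho>)\<^sup>2 / (real n)\<^sup>2" for u v
      using n by (simp add: field_simps power2_eq_square)
    then have "?E (\<lambda>u v. (?X u v - \<rho>)\<^sup>2) = n * (1 - \<rho>\<^sup>2) / (real n)\<^sup>2"
      by (simp add: edge_exp_divide edge_exp_cube_variance)
    also have "\<dots> = (1 - \<rho>\<^sup>2) / n"
      using n by (simp add: power2_eq_square)
    also have "\<dots> \<le> 1 / n"
      by (intro divide_right_mono) auto
    finally have var: "?E (\<lambda>u v. (?X u v - \<rho>)\<^sup>2) \<le> 1 / n" .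
    let ?B = "\<lambda>u v. e / 2 + 2 / \<delta>\<^sup>2 * (?X u v - \<rho>)\<^sup>2"
    have "?E (\<lambda>u v. F (?X u v) - F \<rho>) \<le> ?E ?B"
      using pt cube_w_nonneg[OF \<rho>] by (intro edge_exp_mono) (auto simp: abs_le_iff)
    moreover have "- 1 * ?B u v \<le> F (?X u v) - F \<rho>" for u v
      using abs_le_D2[OF pt[of u v]] by (subst mult_minus1, subst minus_le_iff)
    then have "?E (\<lambda>u v. - 1 * ?B u v) \<le> ?E (\<lambda>u v. F (?X u v) - F \<rho>)"
      using cube_w_nonneg[OF \<rho>] by (intro edge_exp_mono)
    ultimately have "\<bar>?E (\<lambda>u v. F (?X u v) - F \<rho>)\<bar> \<le> ?E ?B"
      unfolding edge_exp_cmult by linarith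
    moreover have "?E (\<lambda>u v. F (?X u v) - F \<rho>) = ?E (\<lambda>u v. F (?X u v)) - F \<rho>"
      by (simp add: edge_exp_diff edge_exp_cube_const)
    moreover have "?E ?B = e / 2 + 2 / \<delta>\<^sup>2 * ?E (\<lambda>u v. (?X u v - \<rho>)\<^sup>2)"
      by (simp only: edge_exp_add edge_exp_cmult edge_exp_cube_const)
    moreover have "2 / \<delta>\<^sup>2 * ?E (\<lambda>u v. (?X u v - \<rho>)\<^sup>2) \<le> 2 / \<delta>\<^sup>2 * (1 / n)"
      using var by (intro mult_left_mono) auto
    moreover have "2 / \<delta>\<^sup>2 * (1 / n) < e / 2"
    proof -
      have "4 / (e * \<delta>\<^sup>2) < n" using M n by linarith
      then show ?thesis using e \<delta>(1) n by (simp add: field_simps)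
    qed
    ultimately show "norm (?E (\<lambda>u v. F (?X u v)) - F \<rho>) < e"
      by simp
  qed
qed

text \<open>Since \<open>((1 + \<rho>) / 2)\<^sup>n\<close> is the probability of a loop, this is \<open>cube_w\<close> conditioned on \<open>u \<noteq> v\<close>.
  Loops contribute nothing to the objective at unit vectors, so conditioning only rescales it.\<close>

definition cube_graph :: "real \<Rightarrow> nat \<Rightarrow> nat \<Rightarrow> nat \<Rightarrow> real" where
  "cube_graph \<rho> n u v = (if u = v then 0 else cube_w \<rho> n u v / (1 - ((1 + \<rho>) / 2) ^ n))"

lemma loop_mass_lt_1:
  assumes "-1 \<le> \<rho>" "\<rho> \<le> 0" "n > 0"
  shows "((1 + \<rho>) / 2) ^ n < (1::real)"
  using assms by (subst power_less_one_iff) auto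

lemma edge_exp_cube_graph:
  "edge_exp (2 ^ n) (cube_graph \<rho> n) g =
    (edge_exp (2 ^ n) (cube_w \<rho> n) g - (\<Sum>u<2 ^ n. cube_w \<rho> n u u * g u u)) / (1 - ((1 + \<rho>) / 2) ^ n)"
proof -
  let ?N = "2 ^ n :: nat" and ?c = "1 - ((1 + \<rho>) / 2) ^ n"
  have "(\<Sum>v<?N. cube_graph \<rho> n u v * g u v)
      = ((\<Sum>v<?N. cube_w \<rho> n u v * g u v) - cube_w \<rho> n u u * g u u) / ?c" if "u < ?N" for u
  proof -
    have "(\<Sum>v<?N. cube_graph \<rho> n u v * g u v)
        = (\<Sum>v<?N. cube_w \<rho> n u v * g u v / ?c - (if u = v then cube_w \<rho> n u u * g u u / ?c else 0))"
      by (intro sum.cong) (auto simp: cube_graph_def)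
    also have "\<dots> = (\<Sum>v<?N. cube_w \<rho> n u v * g u v / ?c) - cube_w \<rho> n u u * g u u / ?c"
      using that by (simp add: sum_subtractf)
    finally show ?thesis by (simp add: sum_divide_distrib diff_divide_distrib)
  qed
  then have "edge_exp ?N (cube_graph \<rho> n) g
      = (\<Sum>u<?N. ((\<Sum>v<?N. cube_w \<rho> n u v * g u v) - cube_w \<rho> n u u * g u u) / ?c)"
    unfolding edge_exp_def by (intro sum.cong) auto
  then show ?thesis
    by (simp add: edge_exp_def sum_subtractf flip: sum_divide_distrib)
qed

lemma wgraph_cube_graph:
  assumes "-1 \<le> \<rho>" "\<rho> \<le> 0" "n > 0"
  shows "wgraph (2 ^ n) (cube_graph \<rho> n)" "no_self_loops (2 ^ n) (cube_graph \<rho> n)"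
proof -
  have lt: "((1 + \<rho>) / 2) ^ n < 1" using loop_mass_lt_1 assms .
  have "edge_exp (2 ^ n) (cube_graph \<rho> n) (\<lambda>_ _. 1) = 1"
    using lt by (simp add: edge_exp_cube_graph edge_exp_cube_1 cube_w_diag)
  then show "wgraph (2 ^ n) (cube_graph \<rho> n)"
    using lt assms by (auto simp: wgraph_def edge_exp_def cube_graph_def cube_w_nonneg)
  show "no_self_loops (2 ^ n) (cube_graph \<rho> n)"
    by (simp add: no_self_loops_def cube_graph_def)
qed

section \<open>Product-state and SDP values of the cube graph\<close>

lemma qmc_obj_cube_graph:
  assumes "\<And>u. u < 2 ^ n \<Longrightarrow> unitv d (f u)"
  shows "qmc_obj d (2 ^ n) (cube_graph \<rho> n) f =
    (1 - edge_exp (2 ^ n) (cube_w \<rho> n) (\<lambda>u v. ip d (f u) (f v))) / 4 / (1 - ((1 + \<rho>) / 2) ^ n)"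
proof -
  have "(\<Sum>u<2 ^ n. cube_w \<rho> n u u * (1 / 4 - 1 / 4 * ip d (f u) (f u))) = 0"
    using assms by (intro sum.neutral) (auto simp: unitv_def)
  then have "qmc_obj d (2 ^ n) (cube_graph \<rho> n) f =
      edge_exp (2 ^ n) (cube_w \<rho> n) (\<lambda>u v. 1 / 4 - 1 / 4 * ip d (f u) (f v)) / (1 - ((1 + \<rho>) / 2) ^ n)"
    unfolding qmc_obj_def edge_exp_cube_graph by simp
  then show ?thesis
    unfolding edge_exp_diff edge_exp_cmult edge_exp_cube_const by (simp only: diff_divide_distrib)
qed

text \<open>The spectral bound does not depend on the dimension: \<open>d = 3\<close> bounds the
  product values, and \<open>d = 2 ^ n\<close> gives SDP optimality.\<close>

lemma qmc_obj_cube_graph_le: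
  assumes "-1 \<le> \<rho>" "\<rho> \<le> 0" "n > 0" "\<And>u. u < 2 ^ n \<Longrightarrow> unitv d (f u)"
  shows "qmc_obj d (2 ^ n) (cube_graph \<rho> n) f \<le> (1 - \<rho>) / 4 / (1 - ((1 + \<rho>) / 2) ^ n)"
  using cube_ip_form_ge[of \<rho> n d f] loop_mass_lt_1[of \<rho> n] assms
  by (subst qmc_obj_cube_graph) (auto intro!: divide_right_mono simp: unitv_def)

lemma Prod_cube_graph_ge:
  assumes "-1 \<le> \<rho>" "\<rho> \<le> 0" "n > 0"
  shows "(1 - \<rho>) / 4 / (1 - ((1 + \<rho>) / 2) ^ n) \<le> Prod (2 ^ n) (cube_graph \<rho> n)"
proof -
  \<comment> \<open>The cut by the lowest digit, placed at the two ends of the first axis of the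
    sphere.\<close>
  let ?f = "\<lambda>u i. if i = 0 then (-1) ^ u else 0 :: real"
  have ip: "ip 3 (?f u) (?f v) = (-1) ^ u * (-1) ^ v" for u v
    by (simp add: ip_def numeral_3_eq_3)
  then have u: "unitv 3 (?f u)" for u
    by (simp add: unitv_def flip: power_add)
  have "qmc_obj 3 (2 ^ n) (cube_graph \<rho> n) ?f = (1 - \<rho>) / 4 / (1 - ((1 + \<rho>) / 2) ^ n)"
    using u assms by (simp add: qmc_obj_cube_graph ip edge_exp_cube_first_bit)
  then have "(1 - \<rho>) / 4 / (1 - ((1 + \<rho>) / 2) ^ n) \<in>
      {qmc_obj 3 (2 ^ n) (cube_graph \<rho> n) f | f. \<forall>u<2 ^ n. unitv 3 (f u)}"
    using u by (auto intro!: exI[of _ ?f])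
  \<comment> \<open>\<open>Prod\<close> is a real supremum, so membership bounds it from below only
    once boundedness is known.\<close>
  moreover have "bdd_above {qmc_obj 3 (2 ^ n) (cube_graph \<rho> n) f | f. \<forall>u<2 ^ n. unitv 3 (f u)}"
    using qmc_obj_cube_graph_le[OF assms]
    by (intro bdd_aboveI[of _ "(1 - \<rho>) / 4 / (1 - ((1 + \<rho>) / 2) ^ n)"]) auto
  ultimately show ?thesis
    unfolding Prod_def by (rule cSup_upper)
qed

text \<open>The cube point scaled to norm 1 and padded with zeros, since SDP vectors live in
  dimension \<open>2 ^ n\<close>.\<close>

definition cube_vec :: "nat \<Rightarrow> nat \<Rightarrow> nat \<Rightarrow> real" where
  "cube_vec n u i = (if i < n then (-1) ^ (u div 2 ^ i) / sqrt n else 0)"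

lemma ip_cube_vec: "ip (2 ^ n) (cube_vec n u) (cube_vec n v) = cube_ip n u v / n"
proof -
  have "ip (2 ^ n) (cube_vec n u) (cube_vec n v) = (\<Sum>i<n. cube_vec n u i * cube_vec n v i)"
    unfolding ip_def using less_exp[of n]
    by (intro sum.mono_neutral_right) (auto simp: cube_vec_def)
  also have "\<dots> = (\<Sum>i<n. (-1) ^ (u div 2 ^ i) * (-1) ^ (v div 2 ^ i) / n)"
    by (intro sum.cong) (auto simp: cube_vec_def)
  finally show ?thesis by (simp add: cube_ip_def sum_divide_distrib)
qed

lemma unitv_cube_vec: "n > 0 \<Longrightarrow> unitv (2 ^ n) (cube_vec n u)"
  by (simp add: unitv_def ip_cube_vec cube_ip_self)

text \<open>The mean inner product is exactly \<rho>, which is equality in the spectral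
  bound.\<close>

lemma sdp_optimal_cube_vec:
  assumes "-1 \<le> \<rho>" "\<rho> \<le> 0" "n > 0"
  shows "sdp_optimal (2 ^ n) (cube_graph \<rho> n) (cube_vec n)"
proof -
  have u: "unitv (2 ^ n) (cube_vec n u)" for u
    using assms by (intro unitv_cube_vec)
  have "qmc_obj (2 ^ n) (2 ^ n) (cube_graph \<rho> n) (cube_vec n) = (1 - \<rho>) / 4 / (1 - ((1 + \<rho>) / 2) ^ n)"
    unfolding qmc_obj_cube_graph[OF u] ip_cube_vec edge_exp_divide edge_exp_cube_ip using assms by simp
  then show ?thesis
    using u qmc_obj_cube_graph_le[OF assms] by (simp add: sdp_optimal_def)
qed

section \<open>Rounding on the noisy hypercube\<close>

lemma rounded_corr_cube_vec:
  assumes "n \<ge> 2"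
  shows "rounded_corr k (2 ^ n) (cube_vec n u) (cube_vec n v) = Fstar k (cube_ip n u v / n)"
proof -
  \<comment> \<open>\<open>n \<ge> 2\<close> gives ambient dimension at least 3, as the reduction to
    \<open>Fstar\<close> requires.\<close>
  have "(2::nat) ^ 2 \<le> 2 ^ n" using assms by (intro power_increasing) auto
  then have "3 \<le> (2::nat) ^ n" by simp
  then show ?thesis
    using assms by (simp add: rounded_corr_eq_Fstar unitv_cube_vec ip_cube_vec)
qed

lemma integral_edge_exp_cube_vec:
  assumes "n \<ge> 2"
  shows "integrable (gauss_mat k (2 ^ n)) (\<lambda>Z. edge_exp (2 ^ n) w
      (\<lambda>u v. cos_angle k (matvec (2 ^ n) Z (cube_vec n u)) (matvec (2 ^ n) Z (cube_vec n v))))"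
    and "(LINT Z | gauss_mat k (2 ^ n). edge_exp (2 ^ n) w
      (\<lambda>u v. cos_angle k (matvec (2 ^ n) Z (cube_vec n u)) (matvec (2 ^ n) Z (cube_vec n v))))
     = edge_exp (2 ^ n) w (\<lambda>u v. Fstar k (cube_ip n u v / n))"
  unfolding edge_exp_def
  by (auto intro!: Bochner_Integration.integrable_sum cos_angle_integrable
      simp: Bochner_Integration.integral_sum cos_angle_integrable
        rounded_corr_cube_vec[OF assms, unfolded rounded_corr_def])

lemma tendsto_edge_exp_Fstar:
  assumes "k > 0" "\<bar>\<rho>\<bar> \<le> 1"
  shows "(\<lambda>n. edge_exp (2 ^ n) (cube_w \<rho> n) (\<lambda>u v. Fstar k (cube_ip n u v / n))) \<longlonglongrightarrow> Fstar k \<rho>"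
  using assms by (intro tendsto_edge_exp_cube continuous_on_Fstar abs_Fstar_le_1)

text \<open>Every rounding is a map into the unit ball, so the spectral bound on the hypercube applies
  to it and survives the limit \<open>n \<longlonglongrightarrow> \<infinity>\<close>.\<close>

lemma Fstar_ge:
  assumes "k > 0" "-1 \<le> \<rho>" "\<rho> \<le> 0"
  shows "\<rho> \<le> Fstar k \<rho>"
proof (rule LIMSEQ_le_const[OF tendsto_edge_exp_Fstar])
  show "\<exists>N. \<forall>n\<ge>N. \<rho> \<le> edge_exp (2 ^ n) (cube_w \<rho> n) (\<lambda>u v. Fstar k (cube_ip n u v / n))"
  proof (intro exI[of _ 2] allI impI)
    fix n :: nat assume n: "n \<ge> 2"
    interpret prob_space "gauss_mat k (2 ^ n)" by (rule prob_space_gauss_mat)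
    show "\<rho> \<le> edge_exp (2 ^ n) (cube_w \<rho> n) (\<lambda>u v. Fstar k (cube_ip n u v / n))"
      unfolding integral_edge_exp_cube_vec(2)[OF n, symmetric]
      by (intro integral_ge_const integral_edge_exp_cube_vec(1) n AE_I2)
        (auto simp: cos_angle_def assms intro!: cube_ip_form_ge ip_vnormalize_self_le_1)
  qed
qed (use assms in auto)

lemma Fstar_le:
  assumes "k > 0" "0 \<le> \<rho>" "\<rho> \<le> 1"
  shows "Fstar k \<rho> \<le> \<rho>"
  using Fstar_ge[of k "- \<rho>"] Fstar_minus[of \<rho> k] assms by simp

lemma Fstar_0: "Fstar k 0 = 0"
  using Fstar_minus[of 0 k] by simp

text \<open>A near-minimizer of the ratio works if it is nonpositive. Otherwise
  \<open>Fstar_le\<close> makes its ratio at least 1, the value at 0, so 0 replaces it.\<close>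

lemma alpha_BOV_approx:
  assumes "\<epsilon> > 0"
  obtains \<rho> where "-1 \<le> \<rho>" "\<rho> \<le> 0" "1 - Fstar 3 \<rho> < (alpha_BOV + \<epsilon>) * (1 - \<rho>)"
proof -
  let ?q = "\<lambda>\<rho>. (1/4 - 1/4 * Fstar 3 \<rho>) / (1/4 - 1/4 * \<rho>)"
  let ?S = "{?q \<rho> | \<rho>. -1 \<le> \<rho> \<and> \<rho> < 1}"
  have "?S \<noteq> {}" by (auto intro!: exI[of _ 0])
  from cInf_lessD[OF this, of "alpha_BOV + \<epsilon>"] assms
  obtain \<rho> where \<rho>: "-1 \<le> \<rho>" "\<rho> < 1" "?q \<rho> < alpha_BOV + \<epsilon>"
    by (auto simp: alpha_BOV_def)
  have q: "?q r = (1 - Fstar 3 r) / (1 - r)" if "r < 1" for r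
    using that by (simp add: divide_simps) (simp add: algebra_simps)
  show ?thesis
  proof (cases "\<rho> \<le> 0")
    case True
    then show ?thesis using \<rho>(1) \<rho>(3)[unfolded q[OF \<rho>(2)]] by (intro that[of \<rho>]) (auto simp: divide_less_eq)
  next
    case False
    then have "1 \<le> ?q \<rho>" using \<rho> Fstar_le[of 3 \<rho>] q[of \<rho>] by simp
    from this \<rho>(3) have "1 < alpha_BOV + \<epsilon>" by (rule le_less_trans)
    then show ?thesis by (intro that[of 0]) (auto simp: Fstar_0)
  qed
qed

lemma alpha_BOV_nonneg: "0 \<le> alpha_BOV"
  unfolding alpha_BOV_def
proof (rule cInf_greatest)
  show "{(1/4 - 1/4 * Fstar 3 \<rho>) / (1/4 - 1/4 * \<rho>) | \<rho>. -1 \<le> \<rho> \<and> \<rho> < 1} \<noteq> {}"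
    by (auto intro!: exI[of _ 0])
next
  fix x assume "x \<in> {(1/4 - 1/4 * Fstar 3 \<rho>) / (1/4 - 1/4 * \<rho>) | \<rho>. -1 \<le> \<rho> \<and> \<rho> < 1}"
  then show "0 \<le> x" using abs_Fstar_le_1[of 3] by (auto simp: abs_le_iff)
qed

text \<open>Expectation and edge sum are exchanged; then the subtracted loop terms, nonnegative
  because \<open>Fstar\<close> is at most 1, are dropped.\<close>

lemma rounded_value_cube_graph_le:
  assumes "-1 \<le> \<rho>" "\<rho> \<le> 0" "n \<ge> 2"
  shows "(LINT Z | gauss_mat k (2 ^ n). edge_exp (2 ^ n) (cube_graph \<rho> n)
      (\<lambda>u v. 1/4 - 1/4 * cos_angle k (matvec (2 ^ n) Z (cube_vec n u)) (matvec (2 ^ n) Z (cube_vec n v))))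
    \<le> (1 - edge_exp (2 ^ n) (cube_w \<rho> n) (\<lambda>u v. Fstar k (cube_ip n u v / n))) / 4 / (1 - ((1 + \<rho>) / 2) ^ n)"
proof -
  interpret prob_space "gauss_mat k (2 ^ n)" by (rule prob_space_gauss_mat)
  let ?F = "\<lambda>u v. Fstar k (cube_ip n u v / n)"
  have n: "n > 0" using assms by simp
  have const: "edge_exp (2 ^ n) (cube_graph \<rho> n) (\<lambda>u v. c) = c" for c
    using wgraph_cube_graph(1)[OF assms(1,2) n] edge_exp_cmult[of "2 ^ n" "cube_graph \<rho> n" c "\<lambda>_ _. 1"]
    by (simp add: wgraph_def edge_exp_def)
  have "(LINT Z | gauss_mat k (2 ^ n). edge_exp (2 ^ n) (cube_graph \<rho> n)
      (\<lambda>u v. 1/4 - 1/4 * cos_angle k (matvec (2 ^ n) Z (cube_vec n u)) (matvec (2 ^ n) Z (cube_vec n v))))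
    = 1/4 - 1/4 * edge_exp (2 ^ n) (cube_graph \<rho> n) ?F"
    unfolding edge_exp_diff edge_exp_cmult const
    using integral_edge_exp_cube_vec[OF assms(3), of k "cube_graph \<rho> n"]
    by (simp add: prob_space)
  also have "\<dots> = edge_exp (2 ^ n) (cube_graph \<rho> n) (\<lambda>u v. 1/4 - 1/4 * ?F u v)"
    unfolding edge_exp_diff edge_exp_cmult const ..
  also have "\<dots> \<le> edge_exp (2 ^ n) (cube_w \<rho> n) (\<lambda>u v. 1/4 - 1/4 * ?F u v) / (1 - ((1 + \<rho>) / 2) ^ n)"
    unfolding edge_exp_cube_graph
  proof (rule divide_right_mono)
    have "0 \<le> 1/4 - 1/4 * ?F u u" for u
      using abs_Fstar_le_1[of k "cube_ip n u u / n"] by (simp add: abs_le_iff)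
    then have "0 \<le> (\<Sum>u<2 ^ n. cube_w \<rho> n u u * (1/4 - 1/4 * ?F u u))"
      using assms by (intro sum_nonneg mult_nonneg_nonneg cube_w_nonneg) auto
    then show "edge_exp (2 ^ n) (cube_w \<rho> n) (\<lambda>u v. 1/4 - 1/4 * ?F u v)
        - (\<Sum>u<2 ^ n. cube_w \<rho> n u u * (1/4 - 1/4 * ?F u u))
      \<le> edge_exp (2 ^ n) (cube_w \<rho> n) (\<lambda>u v. 1/4 - 1/4 * ?F u v)" by linarith
  qed (use loop_mass_lt_1[OF assms(1,2) n] in simp)
  also have "edge_exp (2 ^ n) (cube_w \<rho> n) (\<lambda>u v. 1/4 - 1/4 * ?F u v) = (1 - edge_exp (2 ^ n) (cube_w \<rho> n) ?F) / 4"
    unfolding edge_exp_diff edge_exp_cmult edge_exp_cube_const by simp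
  finally show ?thesis .
qed

theorem theorem2p9:
  fixes \<epsilon> :: real
  assumes "\<epsilon> > 0"
  shows "\<exists>N w fS. wgraph N w \<and> no_self_loops N w \<and> sdp_optimal N w fS \<and>
    (LINT Z | gauss_mat 3 N.
       edge_exp N w (\<lambda>u v. 1/4 - 1/4 * ip 3 (vnormalize 3 (matvec N Z (fS u)))
                                             (vnormalize 3 (matvec N Z (fS v)))))
      \<le> (alpha_BOV + \<epsilon>) * Prod N w"
proof -
  obtain \<rho> where \<rho>: "-1 \<le> \<rho>" "\<rho> \<le> 0" "1 - Fstar 3 \<rho> < (alpha_BOV + \<epsilon>) * (1 - \<rho>)"
    using alpha_BOV_approx[OF assms] .
  let ?V = "\<lambda>n. edge_exp (2 ^ n) (cube_w \<rho> n) (\<lambda>u v. Fstar 3 (cube_ip n u v / n))"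
  have "(\<lambda>n. 1 - ?V n) \<longlonglongrightarrow> 1 - Fstar 3 \<rho>"
    using \<rho> by (intro tendsto_intros tendsto_edge_exp_Fstar) auto
  \<comment> \<open>A strict inequality at the limit already holds at some finite
    \<open>n\<close>.\<close>
  from order_tendstoD(2)[OF this \<rho>(3)]
  have "\<forall>\<^sub>F n in sequentially. 1 - ?V n < (alpha_BOV + \<epsilon>) * (1 - \<rho>) \<and> n \<ge> 2"
    by (intro eventually_conj eventually_ge_at_top)
  then obtain n where n: "1 - ?V n < (alpha_BOV + \<epsilon>) * (1 - \<rho>)" "n \<ge> 2"
    unfolding eventually_sequentially by blast
  have n0: "n > 0" using n by simp
  let ?c = "1 - ((1 + \<rho>) / 2) ^ n"
  have c: "?c > 0" using loop_mass_lt_1[OF \<rho>(1,2) n0] by simp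
  have "(LINT Z | gauss_mat 3 (2 ^ n).
       edge_exp (2 ^ n) (cube_graph \<rho> n) (\<lambda>u v. 1/4 - 1/4 * ip 3 (vnormalize 3 (matvec (2 ^ n) Z (cube_vec n u)))
                                             (vnormalize 3 (matvec (2 ^ n) Z (cube_vec n v)))))
      \<le> (1 - ?V n) / 4 / ?c"
    using rounded_value_cube_graph_le[OF \<rho>(1,2) n(2), of 3] unfolding cos_angle_def .
  also have "\<dots> \<le> (alpha_BOV + \<epsilon>) * (1 - \<rho>) / 4 / ?c"
    using n(1) c by (intro divide_right_mono) auto
  also have "\<dots> = (alpha_BOV + \<epsilon>) * ((1 - \<rho>) / 4 / ?c)"
    by simp
  \<comment> \<open>The loop normalization \<open>?c\<close> scales the rounded value and
    \<open>Prod\<close> alike. Replacing the optimum by \<open>Prod\<close> uses that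
    \<open>alpha_BOV + \<epsilon>\<close> is nonnegative.\<close>
  also have "\<dots> \<le> (alpha_BOV + \<epsilon>) * Prod (2 ^ n) (cube_graph \<rho> n)"
    using Prod_cube_graph_ge[OF \<rho>(1,2) n0] alpha_BOV_nonneg assms by (intro mult_left_mono) auto
  finally show ?thesis
    using wgraph_cube_graph[OF \<rho>(1,2) n0] sdp_optimal_cube_vec[OF \<rho>(1,2) n0] by blast
qed

end
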